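(* Let $q$ be a prime power and $m\ge 1$. Let $\mathrm{U}_m(q)\le \mathrm{GL}_m(q^2)$ be the unitary group, i.e. the isometry group of a non-degenerate unitary (Hermitian) form on $V=\mathbb{F}_{q^2}^m$, and let $\mathrm{AU}_m(q)=V\rtimes \mathrm{U}_m(q)$ act on $V$ via $u\mapsto ua+v$ for $a\in\mathrm{U}_m(q)$, $v\in V$. Then the proportion of derangements in $\mathrm{AU}_m(q)$ (in this action on $V$) is $$\frac{1}{q+1}\left(1-\frac{1}{(-q)^{m(m+3)/2}}\right).$$
   Context: A derangement of a permutation group is an element with no fixed points. The proportion of derangements in a finite permutation group $G$ is $|\{g\in G: g \text{ is a derangement}\}|/|G|$. *)

theory Defs
  imports
    "HOL-Analysis.Cartesian_Space"
    "HOL-Number_Theory.Prime_Powers"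
    "HOL-Algebra.Bij"
begin

text \<open>
  Vectors are row vectors and matrices act on the right, \<open>u v* a\<close> being \<open>ua\<close>. The type
  \<open>'a\<close> is a finite field with \<open>q\<^sup>2\<close> elements, so that \<open>x \<mapsto> x ^ q\<close> is its involutory
  automorphism, and the dimension \<open>m\<close> of \<open>V\<close> is \<open>CARD('m)\<close>.
\<close>

definition hermitian_form ::
    "nat \<Rightarrow> ('a::field ^ 'm::finite \<Rightarrow> 'a ^ 'm \<Rightarrow> 'a) \<Rightarrow> bool" where
  "hermitian_form q B \<longleftrightarrow>
     (\<forall>u v w. B (u + v) w = B u w + B v w) \<and>
     (\<forall>c u v. B (c *s u) v = c * B u v) \<and>
     (\<forall>u v. B v u = B u v ^ q)"

definition nondegenerate :: "('a::field ^ 'm::finite \<Rightarrow> 'a ^ 'm \<Rightarrow> 'a) \<Rightarrow> bool" where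
  "nondegenerate B \<longleftrightarrow> (\<forall>u. (\<forall>v. B u v = 0) \<longrightarrow> u = 0)"

definition unitary_group ::
    "('a::field ^ 'm::finite \<Rightarrow> 'a ^ 'm \<Rightarrow> 'a) \<Rightarrow> ('a ^ 'm ^ 'm) set" where
  "unitary_group B = {a. invertible a \<and> (\<forall>u v. B (u v* a) (v v* a) = B u v)}"

text \<open>
  \<open>V \<rtimes> U\<close>, realised as the group of permutations of \<open>V\<close> it induces; the action is
  faithful, see \<open>card_affine_unitary_group\<close>.
\<close>

definition affine_unitary_group ::
    "('a::field ^ 'm::finite \<Rightarrow> 'a ^ 'm \<Rightarrow> 'a) \<Rightarrow> ('a ^ 'm \<Rightarrow> 'a ^ 'm) set" where
  "affine_unitary_group B = {(\<lambda>u. u v* a + v) |a v. a \<in> unitary_group B}"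

definition derangement :: "('b \<Rightarrow> 'b) \<Rightarrow> bool" where
  "derangement g \<longleftrightarrow> (\<forall>x. g x \<noteq> x)"

definition derangement_proportion :: "('b \<Rightarrow> 'b) set \<Rightarrow> real" where
  "derangement_proportion G = real (card {g \<in> G. derangement g}) / real (card G)"

lemma mat_1_in_unitary_group: "mat 1 \<in> unitary_group B"
  unfolding unitary_group_def invertible_def
  by (auto intro!: exI[of _ "mat 1"])

lemma mult_in_unitary_group:
  assumes "a \<in> unitary_group B" "b \<in> unitary_group B"
  shows "a ** b \<in> unitary_group B"
  using assms unfolding unitary_group_def
  by (auto simp: invertible_mult simp flip: vector_matrix_mul_assoc)

lemma inverse_in_unitary_group:
  assumes "a \<in> unitary_group B"
  obtains b where "b \<in> unitary_group B" "a ** b = mat 1" "b ** a = mat 1"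
proof -
  from assms obtain b where b: "a ** b = mat 1" "b ** a = mat 1"
    unfolding unitary_group_def invertible_def by auto
  have "B (u v* b) (v v* b) = B u v" for u v
  proof -
    have "B (u v* b) (v v* b) = B (u v* b v* a) (v v* b v* a)"
      using assms by (simp add: unitary_group_def)
    then show ?thesis by (simp add: vector_matrix_mul_assoc b)
  qed
  with b have "b \<in> unitary_group B"
    unfolding unitary_group_def invertible_def by auto
  with b that show ?thesis by blast
qed

lemma affine_unitary_group_inverse:
  assumes "g \<in> affine_unitary_group B"
  obtains h where "h \<in> affine_unitary_group B" "g \<circ> h = id" "h \<circ> g = id"
proof -
  from assms obtain a v where g: "g = (\<lambda>u. u v* a + v)" "a \<in> unitary_group B"
    unfolding affine_unitary_group_def by auto
  from inverse_in_unitary_group[OF g(2)] obtain b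
    where b: "b \<in> unitary_group B" "a ** b = mat 1" "b ** a = mat 1" .
  define h where "h = (\<lambda>u. u v* b + (0 - v v* b))"
  have "h \<in> affine_unitary_group B"
    unfolding affine_unitary_group_def h_def using b(1) by blast
  moreover have "g \<circ> h = id" "h \<circ> g = id"
    unfolding g(1) h_def
    by (simp_all add: fun_eq_iff b vector_matrix_mul_assoc
         vector_matrix_left_distrib vector_matrix_mult_diff_distrib)
  ultimately show ?thesis using that by blast
qed

lemma subgroup_affine_unitary_group:
  "subgroup (affine_unitary_group B) (BijGroup UNIV)"
proof -
  have bij: "g \<in> Bij UNIV" if "g \<in> affine_unitary_group B" for g
    using affine_unitary_group_inverse[OF that]
    by (metis Bij_def IntI UNIV_I extensional_UNIV mem_Collect_eq o_bij)
  have comp: "g \<circ> h \<in> affine_unitary_group B"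
    if gh: "g \<in> affine_unitary_group B" "h \<in> affine_unitary_group B" for g h
  proof -
    from gh obtain a v b w where *: "g = (\<lambda>u. u v* a + v)" "a \<in> unitary_group B"
      "h = (\<lambda>u. u v* b + w)" "b \<in> unitary_group B"
      unfolding affine_unitary_group_def by auto
    have "g \<circ> h = (\<lambda>u. u v* (b ** a) + (w v* a + v))"
      unfolding * by (auto simp: fun_eq_iff vector_matrix_left_distrib vector_matrix_mul_assoc)
    with mult_in_unitary_group[OF *(4,2)] show ?thesis
      unfolding affine_unitary_group_def by blast
  qed
  have one: "id \<in> affine_unitary_group B"
  proof -
    have "id = (\<lambda>u :: 'a ^ 'b. u v* mat 1 + 0)" by (simp add: fun_eq_iff)
    then show ?thesis
      unfolding affine_unitary_group_def using mat_1_in_unitary_group[of B] by blast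
  qed
  interpret G: group "BijGroup UNIV :: ('a ^ 'b \<Rightarrow> 'a ^ 'b) monoid"
    by (rule group_BijGroup)
  have mult: "g \<otimes>\<^bsub>BijGroup UNIV\<^esub> h = g \<circ> h" if "g \<in> Bij UNIV" "h \<in> Bij UNIV" for g h :: "'a ^ 'b \<Rightarrow> 'a ^ 'b"
    using that by (auto simp: BijGroup_def compose_def fun_eq_iff)
  have id: "\<one>\<^bsub>BijGroup UNIV\<^esub> = (id :: 'a ^ 'b \<Rightarrow> 'a ^ 'b)"
    by (auto simp: BijGroup_def fun_eq_iff)
  have car: "carrier (BijGroup UNIV) = (Bij UNIV :: ('a ^ 'b \<Rightarrow> 'a ^ 'b) set)"
    by (simp add: BijGroup_def)
  show ?thesis
  proof (rule G.subgroupI)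
    show "affine_unitary_group B \<subseteq> carrier (BijGroup UNIV)" using bij car by auto
    show "affine_unitary_group B \<noteq> {}" using one by auto
    fix g assume g: "g \<in> affine_unitary_group B"
    obtain h where h: "h \<in> affine_unitary_group B" "g \<circ> h = id" "h \<circ> g = id"
      using affine_unitary_group_inverse[OF g] .
    have "inv\<^bsub>BijGroup UNIV\<^esub> g = h"
      by (rule G.inv_equality) (use g h bij mult id car in auto)
    with h show "inv\<^bsub>BijGroup UNIV\<^esub> g \<in> affine_unitary_group B" by simp
  next
    fix g h assume "g \<in> affine_unitary_group B" "h \<in> affine_unitary_group B"
    then show "g \<otimes>\<^bsub>BijGroup UNIV\<^esub> h \<in> affine_unitary_group B"
      using bij mult comp by simp
  qed
qed

lemma card_affine_unitary_group:
  "card (affine_unitary_group (B :: 'a::field ^ 'm::finite \<Rightarrow> _)) =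
     card (unitary_group B) * CARD('a ^ 'm)"
proof -
  let ?f = "\<lambda>(a :: 'a ^ 'm ^ 'm, v :: 'a ^ 'm) u. u v* a + v"
  have "inj ?f"
  proof (rule injI, clarify)
    fix a b :: "'a ^ 'm ^ 'm" and v w :: "'a ^ 'm"
    assume eq: "(\<lambda>u. u v* a + v) = (\<lambda>u. u v* b + w)"
    from fun_cong[OF eq, of 0] have vw: "v = w" by simp
    have "axis i 1 v* a = axis i 1 v* b" for i
      using fun_cong[OF eq, of "axis i 1"] vw by simp
    moreover have "axis i 1 v* c = c $ i" for i and c :: "'a ^ 'm ^ 'm"
      by (simp add: vec_eq_iff vector_matrix_mult_def axis_def if_distrib if_distribR cong: if_cong)
    ultimately have "a $ i = b $ i" for i by metis
    with vw show "a = b \<and> v = w" by (simp add: vec_eq_iff)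
  qed
  moreover have "affine_unitary_group B = ?f ` (unitary_group B \<times> UNIV)"
    unfolding affine_unitary_group_def by auto
  ultimately show ?thesis
    by (simp add: card_image inj_on_subset[of _ UNIV] card_cartesian_product)
qed

end

theory Submission
  imports Defs "HOL-Computational_Algebra.Polynomial"
begin

text \<open>
  The map \<open>u \<mapsto> ua + v\<close> has a fixed point iff \<open>v\<close> lies in the image of \<open>1 - a\<close>, so one has to
  compute the sums over \<open>a \<in> U\<close> of \<open>|im (1 - a)| ^ e\<close> for \<open>e = 0\<close> and \<open>e = 1\<close>.

  The graphs of the isometries \<open>a\<close> are the Lagrangian subspaces of \<open>V \<oplus> V\<close>, with the form
  \<open>B x x' - B y y'\<close>, that meet \<open>0 \<oplus> V\<close> trivially, and \<open>|im (1 - a)|\<close> can be read off from the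
  intersection of the graph with the diagonal. The sum of these weights over all Lagrangian
  subspaces containing a given totally isotropic subspace \<open>R\<close> is a product, by downward induction
  on \<open>dim R\<close>. Moebius inversion over the totally isotropic subspaces \<open>R\<close> of \<open>0 \<oplus> V\<close> then
  expresses both sums in terms of the numbers of such \<open>R\<close>. With \<open>p = -q\<close> the results are
  terminating \<open>p\<close>-hypergeometric sums, and both telescope.
\<close>

section \<open>Finite fields of square order\<close>

text \<open>The sizes of the images of 1 - a are hard to sum over U directly: an isometry is not
  built up one vector at a time with control over its fixed space. A totally isotropic subspace R
  is. A new isotropic vector of \<open>perp R\<close> either enlarges the intersection with the
  diagonal or leaves it unchanged, and the numbers of vectors of both kinds depend only on dim R, so
  each further dimension contributes one factor. What this growth does not control is transversality
  to the second summand V; hence the inversion, in which every R that is not totally isotropic drops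
  out because no Lagrangian contains it.

  The sign in -q has one source: splitting off an anisotropic vector multiplies the deviation of the
  number of isotropic vectors from its main term by -q.

  The sum for e = 0 is the order of U. The sum for e = 1 reduces to two sums of the kind e = 0 in
  dimension m + 1, which explains the exponent (m + 1)(m + 2)/2. It exceeds m(m + 3)/2 by exactly
  one, and this makes the final expression collapse.\<close>

lemma power_card_eq_self:
  fixes x :: "'a::{field,finite}"
  shows "x ^ CARD('a) = x"
proof (cases "x = 0")
  case False
  let ?P = "\<Prod>y\<in>UNIV - {0 :: 'a}. y"
  have "?P = (\<Prod>y\<in>UNIV - {0}. x * y)"
    by (rule prod.reindex_bij_witness[of _ "\<lambda>y. x * y" "\<lambda>y. y / x"]) (use False in auto)
  also have "\<dots> = x ^ (CARD('a) - 1) * ?P"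
    by (simp add: prod.distrib)
  finally have "x ^ (CARD('a) - 1) = 1"
    by simp
  then show ?thesis
    using power_Suc[of x "CARD('a) - 1"] by (simp add: card_gt_0_iff)
qed (simp add: zero_power)

lemma of_nat_card_eq_0: "of_nat CARD('a) = (0 :: 'a::{field,finite})"
proof -
  have "(\<Sum>y\<in>UNIV. y :: 'a) = (\<Sum>y\<in>UNIV. y + 1)"
    by (rule sum.reindex_bij_witness[of _ "\<lambda>y. y + 1" "\<lambda>y. y - 1"]) auto
  then show ?thesis
    by (simp add: sum.distrib)
qed

locale square_field =
  fixes q :: nat and F :: "'a::{field,finite} itself"
  assumes primepow_q: "primepow q" and card_field: "CARD('a) = q\<^sup>2"
begin

lemma q_gt_1: "q > 1"
  using primepow_q by (rule primepow_gt_Suc_0[unfolded One_nat_def[symmetric]])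

lemma add_power_q: "(x + y) ^ q = x ^ q + (y :: 'a) ^ q"
proof -
  obtain r k where rk: "prime r" "k > 0" "q = r ^ k"
    using primepow_q unfolding primepow_def by auto
  have "CHAR('a) > 0"
    by (rule finite_imp_CHAR_pos) simp
  then have prime: "prime CHAR('a)"
    by (rule prime_CHAR_semidom)
  \<comment> \<open>The characteristic is a prime divisor of a power of \<open>r\<close>, so it is
    \<open>r\<close>, and raising to the power \<open>q\<close> is an iterate of Frobenius.\<close>
  have "CHAR('a) dvd CARD('a)"
    using of_nat_card_eq_0[where 'a = 'a] by (simp only: of_nat_eq_0_iff_char_dvd)
  then have "CHAR('a) dvd r"
    using prime_dvd_power[OF prime, of r "k * 2"] by (simp add: card_field rk(3) power_mult)
  then have "CHAR('a) = r"
    using prime rk(1) primes_dvd_imp_eq by blast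
  then show ?thesis
    using freshmans_dream'[OF prime, of q k] rk(3) by simp
qed

lemma zero_power_q: "(0 :: 'a) ^ q = 0"
  using q_gt_1 by (simp add: zero_power)

lemma power_q_eq_0_iff: "(x :: 'a) ^ q = 0 \<longleftrightarrow> x = 0"
  using q_gt_1 by simp

lemma minus_power_q: "(- x :: 'a) ^ q = - (x ^ q)"
proof -
  have "(- x) ^ q + x ^ q = 0"
    using add_power_q[of "- x" x] zero_power_q by simp
  then show ?thesis
    by (simp only: eq_neg_iff_add_eq_0)
qed

lemma diff_power_q: "(x - y :: 'a) ^ q = x ^ q - y ^ q"
  using add_power_q[of x "- y"] by (simp add: minus_power_q)

text \<open>The trace is a polynomial of degree \<open>q\<close>, too small to vanish on all
  \<open>q\<^sup>2\<close> elements. Its non-vanishing allows polarisation in every characteristic,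
  including 2.\<close>

lemma ex_trace_neq_0: "\<exists>t :: 'a. t + t ^ q \<noteq> 0"
proof (rule ccontr)
  assume *: "\<nexists>t :: 'a. t + t ^ q \<noteq> 0"
  define f where "f = monom (1 :: 'a) 1 + monom 1 q"
  have "coeff f q = 1"
    using q_gt_1 by (simp add: f_def)
  then have "f \<noteq> 0" by auto
  have "degree f \<le> q"
    unfolding f_def using q_gt_1 by (intro degree_add_le) (auto simp: degree_monom_eq)
  moreover have "{x. poly f x = 0} = UNIV"
    using * by (auto simp: f_def poly_monom)
  ultimately have "q\<^sup>2 \<le> q"
    using card_poly_roots_bound[OF \<open>f \<noteq> 0\<close>] card_field by simp
  then show False
    using q_gt_1 by (simp add: power2_eq_square)
qed

lemma card_norm_fibre_le: "card {x :: 'a. x ^ Suc q = e} \<le> Suc q"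
proof -
  define f where "f = monom (1 :: 'a) (Suc q) + [:- e:]"
  have "coeff f (Suc q) = 1"
    by (simp add: f_def)
  then have "f \<noteq> 0" by auto
  have "degree f \<le> Suc q"
    unfolding f_def by (intro degree_add_le) (auto simp: degree_monom_eq)
  moreover have "{x. poly f x = 0} = {x :: 'a. x ^ Suc q = e}"
    by (auto simp: f_def poly_monom)
  ultimately show ?thesis
    using card_poly_roots_bound[OF \<open>f \<noteq> 0\<close>] by simp
qed

text \<open>
  The norm maps the \<open>(q + 1) (q - 1)\<close> units into the at most \<open>q - 1\<close> roots of \<open>X ^ (q - 1) - 1\<close>,
  and its fibres have at most \<open>q + 1\<close> elements, so all fibres must be full.
\<close>

lemma card_norm_fibre:
  fixes e :: 'a
  assumes "e ^ q = e" "e \<noteq> 0"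
  shows "card {x. x ^ Suc q = e} = Suc q"
proof -
  define E where "E = {e :: 'a. e ^ (q - 1) = 1}"
  have q: "Suc (q - 1) = q"
    using q_gt_1 by simp
  have e_E: "e \<in> E"
    using assms power_Suc[of e "q - 1"] unfolding q E_def by simp
  have card_E: "card E \<le> q - 1"
  proof -
    define f where "f = monom (1 :: 'a) (q - 1) + [:- 1:]"
    have "coeff f (q - 1) = 1"
      using q_gt_1 by (simp add: f_def coeff_pCons split: nat.split)
    then have "f \<noteq> 0" by auto
    have "degree f \<le> q - 1"
      unfolding f_def by (intro degree_add_le) (auto simp: degree_monom_eq)
    moreover have "{x. poly f x = 0} = E"
      by (auto simp: f_def poly_monom E_def)
    ultimately show ?thesis
      using card_poly_roots_bound[OF \<open>f \<noteq> 0\<close>] by simp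
  qed
  have norm_E: "x ^ Suc q \<in> E" if "x \<noteq> 0" for x :: 'a
  proof -
    have eq: "Suc (Suc q * (q - 1)) = q\<^sup>2"
      using q_gt_1 by (cases q) (auto simp: power2_eq_square)
    have "x * x ^ (Suc q * (q - 1)) = x"
      using power_card_eq_self[of x] by (simp only: power_Suc[symmetric] eq card_field)
    then show ?thesis
      using that by (simp only: E_def mem_Collect_eq power_mult[symmetric]) simp
  qed
  have "(\<Sum>d\<in>E. card {x :: 'a. x ^ Suc q = d}) = card (\<Union>d\<in>E. {x. x ^ Suc q = d})"
    by (rule card_UN_disjoint[symmetric]) auto
  also have "\<dots> = card (UNIV - {0 :: 'a})"
  proof (rule arg_cong[where f = card])
    have "0 \<notin> E"
      by (cases "q = 2") (use q_gt_1 in \<open>auto simp: E_def zero_power\<close>)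
    then show "(\<Union>d\<in>E. {x. x ^ Suc q = d}) = UNIV - {0}"
      using norm_E by auto
  qed
  also have "\<dots> = q\<^sup>2 - 1"
    by (simp add: card_Diff_singleton card_field)
  finally have total: "(\<Sum>d\<in>E. card {x :: 'a. x ^ Suc q = d}) = q\<^sup>2 - 1" .
  show ?thesis
  proof (rule ccontr)
    assume "card {x. x ^ Suc q = e} \<noteq> Suc q"
    then have "card {x. x ^ Suc q = e} < Suc q"
      using card_norm_fibre_le[of e] by simp
    then have "(\<Sum>d\<in>E. card {x :: 'a. x ^ Suc q = d}) < (\<Sum>d\<in>E. Suc q)"
      using e_E card_norm_fibre_le by (intro sum_strict_mono_ex1) auto
    also have "\<dots> \<le> (q - 1) * Suc q"
      using card_E by (simp only: sum_constant of_nat_id mult_le_mono1)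
    also have "\<dots> = q\<^sup>2 - 1"
      by (simp add: power2_eq_square algebra_simps)
    finally show False
      using total by simp
  qed
qed

end

section \<open>Linear algebra by counting: cardinalities in place of dimensions\<close>

lemma bij_betw_split_functional:
  fixes W :: "('a::field ^ 'n::finite) set"
  assumes W: "vec.subspace W"
    and add: "\<And>u v. f (u + v) = f u + f v" and scale: "\<And>c u. f (c *s u) = c * f u"
    and u: "u \<in> W" "f u \<noteq> 0"
  shows "bij_betw (\<lambda>(c, w). c *s u + w) (UNIV \<times> {w \<in> W. f w = 0}) W"
proof (rule bij_betw_byWitness[where f' = "\<lambda>w. (f w / f u, w - (f w / f u) *s u)"])
  have diff: "f (v - w) = f v - f w" for v w
    using add[of "v - w" w] by simp
  show "(\<lambda>w. (f w / f u, w - (f w / f u) *s u)) ` W \<subseteq> UNIV \<times> {w \<in> W. f w = 0}"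
    using u W by (auto simp: diff scale vec.subspace_diff vec.subspace_scale)
  show "(\<lambda>(c, w). c *s u + w) ` (UNIV \<times> {w \<in> W. f w = 0}) \<subseteq> W"
    using u W by (auto intro: vec.subspace_add vec.subspace_scale)
qed (use u in \<open>auto simp: add scale\<close>)

lemma card_subspace_functional:
  fixes W :: "('a::{field,finite} ^ 'n::finite) set"
  assumes "vec.subspace W"
    and "\<And>u v. f (u + v) = f u + f v" "\<And>c u. f (c *s u) = c * f u"
    and "u \<in> W" "f u \<noteq> 0"
  shows "card W = CARD('a) * card {w \<in> W. f w = 0}"
  using bij_betw_same_card[OF bij_betw_split_functional[OF assms]]
  by (simp add: card_cartesian_product)

text \<open>Cutting with a coordinate hyperplane that does not contain \<open>W\<close> divides the
  size by that of the field, so the induction runs on cardinality alone.\<close>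

lemma card_subspace_power:
  fixes W :: "('a::{field,finite} ^ 'n::finite) set"
  assumes "vec.subspace W"
  shows "\<exists>d. card W = CARD('a) ^ d"
  using assms
proof (induction "card W" arbitrary: W rule: less_induct)
  case less
  show ?case
  proof (cases "W = {0}")
    case False
    then obtain u where u: "u \<in> W" "u \<noteq> 0"
      using vec.subspace_0[OF less.prems] by auto
    then obtain i where i: "u $ i \<noteq> 0"
      by (auto simp: vec_eq_iff)
    let ?K = "{w \<in> W. w $ i = 0}"
    have W: "card W = CARD('a) * card ?K"
      by (rule card_subspace_functional[where f = "\<lambda>w. w $ i", OF less.prems _ _ u(1)]) (use i in auto)
    have "card ?K < card W"
      using u i by (intro psubset_card_mono) auto
    moreover have "vec.subspace ?K"
      using less.prems by (auto simp: vec.subspace_def)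
    ultimately obtain d where "card ?K = CARD('a) ^ d"
      using less.hyps by blast
    with W have "card W = CARD('a) ^ Suc d" by simp
    then show ?thesis ..
  qed (auto intro: exI[of _ 0])
qed

text \<open>Every fibre of the addition map on \<open>U \<times> W\<close> is a translate of the
  antidiagonal copy of \<open>U \<inter> W\<close>.\<close>

lemma card_subspace_sum:
  fixes U W :: "('a::{field,finite} ^ 'n::finite) set"
  assumes U: "vec.subspace U" and W: "vec.subspace W"
  shows "card {u + w |u w. u \<in> U \<and> w \<in> W} * card (U \<inter> W) = card U * card W"
proof -
  let ?S = "{u + w |u w. u \<in> U \<and> w \<in> W}"
  let ?f = "\<lambda>(u, w). u + w"
  have fibre: "card {x \<in> U \<times> W. ?f x = s} = card (U \<inter> W)" if "s \<in> ?S" for s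
  proof -
    from that obtain u w where s: "s = u + w" "u \<in> U" "w \<in> W"
      by blast
    have "bij_betw (\<lambda>v. (u + v, w - v)) (U \<inter> W) {x \<in> U \<times> W. ?f x = s}"
    proof (rule bij_betw_byWitness[where f' = "\<lambda>x. fst x - u"])
      show "(\<lambda>x. fst x - u) ` {x \<in> U \<times> W. ?f x = s} \<subseteq> U \<inter> W"
      proof (rule image_subsetI)
        fix x assume x: "x \<in> {x \<in> U \<times> W. ?f x = s}"
        then have "fst x - u = w - snd x"
          using s by (auto simp: algebra_simps)
        moreover have "fst x - u \<in> U" "w - snd x \<in> W"
          using x s U W by (auto simp: vec.subspace_diff)
        ultimately show "fst x - u \<in> U \<inter> W" by simp
      qed
    qed (use s U W in \<open>auto simp: vec.subspace_add vec.subspace_diff algebra_simps\<close>)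
    then show ?thesis
      by (simp add: bij_betw_same_card)
  qed
  have "card U * card W = card (\<Union>s\<in>?S. {x \<in> U \<times> W. ?f x = s})"
    unfolding card_cartesian_product[symmetric] by (rule arg_cong[where f = card]) (auto, blast)
  also have "\<dots> = (\<Sum>s\<in>?S. card {x \<in> U \<times> W. ?f x = s})"
    by (rule card_UN_disjoint) auto
  also have "\<dots> = card ?S * card (U \<inter> W)"
    using fibre by simp
  finally show ?thesis by simp
qed

lemma card_span_insert:
  fixes R :: "('a::{field,finite} ^ 'n::finite) set"
  assumes R: "vec.subspace R" and w: "w \<notin> R"
  shows "card (vec.span (insert w R)) = CARD('a) * card R"
proof -
  have "inj_on (\<lambda>(c, r). c *s w + r) (UNIV \<times> R)"
  proof (rule inj_onI, clarify)
    fix c r d s assume rs: "r \<in> R" "s \<in> R" and eq: "c *s w + r = d *s w + s"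
    have *: "(c - d) *s w = s - r"
      using eq by (simp add: vec.scale_left_diff_distrib algebra_simps)
    have "c = d"
    proof (rule ccontr)
      assume "c \<noteq> d"
      then have "w = (1 / (c - d)) *s (s - r)"
        by (simp flip: *)
      then show False
        using w rs R by (metis vec.subspace_diff vec.subspace_scale)
    qed
    with eq show "c = d \<and> r = s" by simp
  qed
  moreover have "vec.span (insert w R) = (\<lambda>(c, r). c *s w + r) ` (UNIV \<times> R)"
  proof -
    have span_R: "vec.span R = R"
      using R by simp
    show ?thesis
    proof (rule Set.set_eqI, unfold vec.span_breakdown_eq span_R)
      fix x
      show "(\<exists>k. x - k *s w \<in> R) \<longleftrightarrow> x \<in> (\<lambda>(c, r). c *s w + r) ` (UNIV \<times> R)"
      proof
        assume "\<exists>k. x - k *s w \<in> R"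
        then obtain k where "x - k *s w \<in> R" ..
        then show "x \<in> (\<lambda>(c, r). c *s w + r) ` (UNIV \<times> R)"
          by (intro image_eqI[of _ _ "(k, x - k *s w)"]) auto
      next
        assume "x \<in> (\<lambda>(c, r). c *s w + r) ` (UNIV \<times> R)"
        then obtain c r where "x - c *s w = r" "r \<in> R"
          by (auto simp: algebra_simps)
        then show "\<exists>k. x - k *s w \<in> R"
          by blast
      qed
    qed
  qed
  ultimately show ?thesis
    by (simp add: card_image card_cartesian_product)
qed

section \<open>Hermitian spaces\<close>

locale hermitian_space = square_field q "TYPE('a)"
  for q and B :: "'a::{field,finite} ^ 'n::finite \<Rightarrow> 'a ^ 'n \<Rightarrow> 'a" +
  assumes hermitian: "hermitian_form q B" and nondegenerate: "nondegenerate B"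
begin

lemma B_add_left: "B (u + v) w = B u w + B v w"
  and B_scale_left: "B (c *s u) w = c * B u w"
  and B_conj: "B v u = B u v ^ q"
  using hermitian unfolding hermitian_form_def by blast+

lemma B_add_right: "B w (u + v) = B w u + B w v"
  by (subst (1 2 3) B_conj) (simp add: B_add_left add_power_q)

lemma B_scale_right: "B w (c *s u) = c ^ q * B w u"
  by (subst (1 2) B_conj) (simp add: B_scale_left power_mult_distrib)

lemma B_zero_left: "B 0 w = 0"
  using B_scale_left[of 0] by simp

lemma B_zero_right: "B w 0 = 0"
  using B_scale_right[of w 0] by (simp add: zero_power_q)

lemma B_diff_left: "B (u - v) w = B u w - B v w"
  using B_add_left[of "u - v" v] by simp

lemma B_diff_right: "B w (u - v) = B w u - B w v"
  using B_add_right[of w "u - v" v] by simp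

lemma B_eq_0_commute: "B u v = 0 \<longleftrightarrow> B v u = 0"
  by (subst B_conj) (simp add: power_q_eq_0_iff del: power_eq_0_iff)

lemma eq_0_if_orthogonal: "(\<And>v. B u v = 0) \<Longrightarrow> u = 0"
  using nondegenerate unfolding nondegenerate_def by blast

definition perp :: "('a ^ 'n) set \<Rightarrow> ('a ^ 'n) set" where
  "perp W = {v. \<forall>w\<in>W. B v w = 0}"

definition isotropic :: "('a ^ 'n) set" where
  "isotropic = {v. B v v = 0}"

lemma subspace_perp: "vec.subspace (perp W)"
  by (auto simp: perp_def vec.subspace_def B_zero_left B_add_left B_scale_left)

lemma perp_UNIV: "perp UNIV = {0}"
  using eq_0_if_orthogonal by (auto simp: perp_def B_zero_left)

lemma subset_perp_commute: "U \<subseteq> perp W \<longleftrightarrow> W \<subseteq> perp U"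
  using B_eq_0_commute by (auto simp: perp_def)

lemma perp_span: "perp (vec.span S) = perp S"
proof
  show "perp (vec.span S) \<subseteq> perp S"
    using vec.span_base by (auto simp: perp_def)
  have "vec.span S \<subseteq> perp (perp S)"
    using subset_perp_commute[of "perp S" S] by (intro vec.span_minimal subspace_perp) auto
  then show "perp S \<subseteq> perp (vec.span S)"
    using subset_perp_commute by blast
qed

text \<open>A vector \<open>r\<close> is orthogonal to all of \<open>W\<close> if it lies in
  \<open>perp W\<close>, and otherwise to a hyperplane of \<open>W\<close>. Multiplying by the field
  size avoids a division.\<close>

lemma card_orthogonal_pairs:
  assumes W: "vec.subspace W"
  shows "CARD('a) * card {(r, w). r \<in> R \<and> w \<in> W \<and> B r w = 0} =
           card (R \<inter> perp W) * (CARD('a) - 1) * card W + card R * card W"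
proof -
  have fibre: "CARD('a) * card {w \<in> W. B r w = 0} =
      (if r \<in> perp W then (CARD('a) - 1) * card W else 0) + card W" for r
  proof (cases "r \<in> perp W")
    case True
    then have "{w \<in> W. B r w = 0} = W"
      by (auto simp: perp_def)
    moreover have "CARD('a) > 0" by simp
    ultimately show ?thesis
      using True by (simp add: diff_mult_distrib)
  next
    case False
    then obtain u where "u \<in> W" "B u r \<noteq> 0"
      using B_eq_0_commute by (auto simp: perp_def)
    from card_subspace_functional[OF W B_add_left B_scale_left this]
    have "card W = CARD('a) * card {w \<in> W. B r w = 0}"
      using B_eq_0_commute by auto
    then show ?thesis
      using False by simp
  qed
  have "{(r, w). r \<in> R \<and> w \<in> W \<and> B r w = 0} = (SIGMA r:R. {w \<in> W. B r w = 0})"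
    by auto
  then have "CARD('a) * card {(r, w). r \<in> R \<and> w \<in> W \<and> B r w = 0} =
      (\<Sum>r\<in>R. CARD('a) * card {w \<in> W. B r w = 0})"
    by (simp add: sum_distrib_left)
  also have "\<dots> = card (R \<inter> perp W) * ((CARD('a) - 1) * card W) + card R * card W"
    by (simp add: fibre sum.distrib flip: sum.inter_restrict)
  finally show ?thesis
    by (simp add: mult.assoc)
qed

lemma card_field_gt_1: "CARD('a) > 1"
  using q_gt_1 one_less_power[of q 2] by (simp add: card_field)

text \<open>Orthogonality is symmetric, so the same pairs are counted from either side. For
  \<open>W = UNIV\<close> this is the dimension formula for the orthogonal complement.\<close>

lemma card_Int_perp:
  assumes "vec.subspace R" "vec.subspace W"
  shows "card (R \<inter> perp W) * card W = card (W \<inter> perp R) * card R"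
proof -
  have "{(r, w). r \<in> R \<and> w \<in> W \<and> B r w = 0} = prod.swap ` {(w, r). w \<in> W \<and> r \<in> R \<and> B w r = 0}"
    using B_eq_0_commute by (auto simp: image_iff)
  then have "card {(r, w). r \<in> R \<and> w \<in> W \<and> B r w = 0} = card {(w, r). w \<in> W \<and> r \<in> R \<and> B w r = 0}"
    by (simp add: card_image)
  then show ?thesis
    using card_orthogonal_pairs[OF assms(2), of R] card_orthogonal_pairs[OF assms(1), of W]
      card_field_gt_1 by simp
qed

lemma card_perp:
  assumes "vec.subspace R"
  shows "card (perp R) * card R = CARD('a) ^ CARD('n)"
  using card_Int_perp[OF assms vec.subspace_UNIV] vec.subspace_0[OF assms]
  by (simp add: perp_UNIV)

lemma perp_perp:
  assumes R: "vec.subspace R"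
  shows "perp (perp R) = R"
proof (rule card_subset_eq[symmetric])
  show "R \<subseteq> perp (perp R)"
    using subset_perp_commute by blast
  have "card (perp R) > 0"
    using vec.subspace_0[OF subspace_perp[of R]] by (auto simp: card_gt_0_iff)
  then show "card R = card (perp (perp R))"
    using card_perp[OF R] card_perp[OF subspace_perp[of R]] by (metis mult.commute mult_cancel1 less_irrefl)
qed simp

lemma totally_isotropic_if_isotropic:
  assumes W: "vec.subspace W" and iso: "W \<subseteq> isotropic"
  shows "W \<subseteq> perp W"
proof
  fix u assume u: "u \<in> W"
  have "B u v = 0" if v: "v \<in> W" for v
  proof (rule ccontr)
    assume b: "B u v \<noteq> 0"
    obtain t :: 'a where t: "t + t ^ q \<noteq> 0"
      using ex_trace_neq_0 by blast
    \<comment> \<open>Chosen so that the two cross terms in the form value of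
      \<open>c *s u + v\<close> add up to the nonzero trace \<open>t + t ^ q\<close>.\<close>
    define c where "c = t / B u v"
    have "c *s u + v \<in> W"
      using u v W by (intro vec.subspace_add vec.subspace_scale)
    then have "B (c *s u + v) (c *s u + v) = 0" "B u u = 0" "B v v = 0"
      using iso u v by (auto simp: isotropic_def)
    moreover have "B (c *s u + v) (c *s u + v) =
        c * c ^ q * B u u + c * B u v + (c * B u v) ^ q + B v v"
      by (simp add: B_add_left B_add_right B_scale_left B_scale_right B_conj[of v u]
          power_mult_distrib algebra_simps)
    ultimately show False
      using t b by (simp add: c_def)
  qed
  then show "u \<in> perp W"
    by (simp add: perp_def)
qed

text \<open>
  For \<open>w\<close> orthogonal to \<open>u\<close>, the vector \<open>c *s u + w\<close> is isotropic only for \<open>c = 0\<close> if \<open>w\<close> is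
  isotropic, and for exactly \<open>q + 1\<close> values of \<open>c\<close> otherwise.
\<close>

lemma card_isotropic_split:
  assumes W: "vec.subspace W" and u: "u \<in> W" "B u u \<noteq> 0"
  defines "W' \<equiv> {w \<in> W. B w u = 0}"
  shows "card (W \<inter> isotropic) + q * card (W' \<inter> isotropic) = (q + 1) * card W'"
proof -
  have B_uw: "B u w = 0" "B w u = 0" if "w \<in> W'" for w
    using that B_eq_0_commute by (auto simp: W'_def)
  have norm: "B (c *s u + w) (c *s u + w) = c ^ Suc q * B u u + B w w" if "w \<in> W'" for c w
    using B_uw[OF that] by (simp add: B_add_left B_add_right B_scale_left B_scale_right)
  have fibre: "card {c. B (c *s u + w) (c *s u + w) = 0} = (if w \<in> isotropic then 1 else q + 1)"
    if w: "w \<in> W'" for w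
  proof (cases "w \<in> isotropic")
    case True
    then have "{c. B (c *s u + w) (c *s u + w) = 0} = {0}"
      using u by (auto simp: norm[OF w] isotropic_def)
    then show ?thesis
      using True by simp
  next
    case False
    define e where "e = - B w w / B u u"
    have "e \<noteq> 0"
      using False u by (simp add: e_def isotropic_def)
    moreover have "e ^ q = e"
      by (simp add: e_def power_divide minus_power_q flip: B_conj)
    ultimately have "card {c :: 'a. c ^ Suc q = e} = Suc q"
      by (rule card_norm_fibre[rotated])
    moreover have "{c. B (c *s u + w) (c *s u + w) = 0} = {c. c ^ Suc q = e}"
      unfolding norm[OF w] e_def using u
      by (simp add: eq_divide_eq eq_neg_iff_add_eq_0 del: power_Suc divide_minus_left minus_divide_left)
    ultimately show ?thesis
      using False by simp
  qed
  let ?f = "\<lambda>(c, w). c *s u + w"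
  have bij: "bij_betw ?f (UNIV \<times> W') W"
    unfolding W'_def by (rule bij_betw_split_functional[OF W B_add_left B_scale_left u])
  have "bij_betw ?f {x \<in> UNIV \<times> W'. ?f x \<in> isotropic} (W \<inter> isotropic)"
    by (rule bij_betw_subset[OF bij]) (use bij in \<open>auto simp: bij_betw_def\<close>)
  then have "card (W \<inter> isotropic) = card {x \<in> UNIV \<times> W'. ?f x \<in> isotropic}"
    by (simp add: bij_betw_same_card)
  also have "\<dots> = card (prod.swap ` (SIGMA w:W'. {c. B (c *s u + w) (c *s u + w) = 0}))"
    by (rule arg_cong[where f = card]) (auto simp: isotropic_def image_iff)
  also have "\<dots> = (\<Sum>w\<in>W'. if w \<in> isotropic then 1 else q + 1)"
    by (simp add: card_image fibre)
  finally have "card (W \<inter> isotropic) + q * card (W' \<inter> isotropic) =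
      (\<Sum>w\<in>W'. (if w \<in> isotropic then 1 else q + 1) + (if w \<in> isotropic then q else 0))"
    by (simp add: sum.distrib flip: sum.inter_restrict)
  also have "\<dots> = (\<Sum>w\<in>W'. q + 1)"
    by (rule sum.cong) auto
  finally show ?thesis by simp
qed

text \<open>As \<open>u\<close> is anisotropic, \<open>W\<close> is the orthogonal sum of its line
  and \<open>W'\<close>, and a line of this kind adds nothing to the radical. This keeps
  \<open>e\<close> constant in the induction for \<open>card_isotropic\<close>.\<close>

lemma radical_split:
  assumes W: "vec.subspace W" and u: "u \<in> W" "B u u \<noteq> 0"
  defines "W' \<equiv> {w \<in> W. B w u = 0}"
  shows "W' \<inter> perp W' = W \<inter> perp W"
proof
  show "W \<inter> perp W \<subseteq> W' \<inter> perp W'"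
    using u by (auto simp: W'_def perp_def)
  show "W' \<inter> perp W' \<subseteq> W \<inter> perp W"
  proof
    fix r assume r: "r \<in> W' \<inter> perp W'"
    have "B r w = 0" if w: "w \<in> W" for w
    proof -
      define c where "c = B w u / B u u"
      have "w - c *s u \<in> W'"
        using w u W by (auto simp: W'_def vec.subspace_diff vec.subspace_scale B_diff_left
            B_scale_left c_def)
      then have "B r (w - c *s u) = 0" "B r u = 0"
        using r by (auto simp: perp_def W'_def)
      then show ?thesis
        by (simp add: B_diff_right B_scale_right)
    qed
    then show "r \<in> W \<inter> perp W"
      using r by (auto simp: perp_def W'_def)
  qed
qed

text \<open>Here \<open>n\<close> is the dimension of \<open>W\<close> and \<open>e\<close> that of
  its radical. Splitting off an anisotropic vector turns the deviation from the main term
  \<open>q ^ (2 * n)\<close> into \<open>- q\<close> times itself, and the process ends in a totally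
  isotropic space, where \<open>n = e\<close>. The factor \<open>int q\<close> on the left avoids
  the exponent \<open>2 * n - 1\<close>, which would be truncated at \<open>n = 0\<close>.\<close>

lemma card_isotropic:
  assumes "vec.subspace W" "card W = CARD('a) ^ n" "card (W \<inter> perp W) = CARD('a) ^ e"
  shows "int q * int (card (W \<inter> isotropic)) = int q ^ (2 * n) + (int q - 1) * (- int q) ^ (n + e)"
  using assms
proof (induction n arbitrary: W rule: less_induct)
  case (less n)
  note W = less.prems(1)
  show ?case
  proof (cases "W \<subseteq> isotropic")
    case True
    then have "W \<inter> perp W = W" "W \<inter> isotropic = W"
      using totally_isotropic_if_isotropic[OF W] by auto
    moreover from this have "n = e"
      using less.prems(2,3) card_field_gt_1 power_inject_exp by metis
    ultimately show ?thesis
      using less.prems(2)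
      by (simp add: card_field algebra_simps flip: mult_2 power_mult)
  next
    case False
    then obtain u where u: "u \<in> W" "B u u \<noteq> 0"
      by (auto simp: isotropic_def)
    define W' where "W' = {w \<in> W. B w u = 0}"
    have card_W: "card W = CARD('a) * card W'"
      unfolding W'_def by (rule card_subspace_functional[OF W B_add_left B_scale_left u])
    obtain k where n: "n = Suc k"
      using card_W less.prems(2) card_field_gt_1 by (cases n) auto
    have W': "vec.subspace W'"
      using W by (auto simp: W'_def vec.subspace_def B_zero_left B_add_left B_scale_left)
    have card_W': "card W' = CARD('a) ^ k"
      using card_W less.prems(2) n by simp
    have IH: "int q * int (card (W' \<inter> isotropic)) =
        int q ^ (2 * k) + (int q - 1) * (- int q) ^ (k + e)"
      using n less.prems(3) card_W' W' radical_split[OF W u, folded W'_def]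
      by (intro less.IH) auto
    have "card (W \<inter> isotropic) + q * card (W' \<inter> isotropic) = (q + 1) * q ^ (2 * k)"
      using card_isotropic_split[OF W u, folded W'_def] card_W' by (simp add: card_field power_mult)
    then have "int (card (W \<inter> isotropic)) =
        (int q + 1) * int q ^ (2 * k) - int q * int (card (W' \<inter> isotropic))"
      using arg_cong[where f = int] by (fastforce simp: algebra_simps)
    then have "int q * int (card (W \<inter> isotropic)) =
        int q * ((int q + 1) * int q ^ (2 * k) -
          (int q ^ (2 * k) + (int q - 1) * (- int q) ^ (k + e)))"
      by (simp only: IH)
    also have "\<dots> = int q ^ (2 * n) + (int q - 1) * (- int q) ^ (n + e)"
      by (simp add: n algebra_simps)
    finally show ?thesis .
  qed
qed

end

section \<open>Weighted sums over Lagrangian subspaces\<close>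

lemma subspace_Int:
  "vec.subspace U \<Longrightarrow> vec.subspace W \<Longrightarrow> vec.subspace (U \<inter> W)"
  by (auto simp: vec.subspace_def)

lemma span_insert_subspace_iff:
  assumes "vec.subspace R"
  shows "x \<in> vec.span (insert w R) \<longleftrightarrow> (\<exists>c. x - c *s w \<in> R)"
proof -
  have "vec.span R = R"
    using assms by simp
  then show ?thesis
    by (simp only: vec.span_breakdown_eq)
qed

locale split_hermitian_space = hermitian_space q B
  for q and B :: "'a::{field,finite} ^ 'n::finite \<Rightarrow> 'a ^ 'n \<Rightarrow> 'a" +
  fixes m :: nat and D :: "('a ^ 'n) set"
  assumes dim: "CARD('n) = 2 * m"
    and subspace_D: "vec.subspace D" and D_isotropic: "D \<subseteq> perp D" and card_D: "card D = CARD('a) ^ m"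
begin

definition lagrangian :: "('a ^ 'n) set \<Rightarrow> bool" where
  "lagrangian L \<longleftrightarrow> vec.subspace L \<and> L \<subseteq> perp L \<and> card L = CARD('a) ^ m"

text \<open>If \<open>D\<close> is the diagonal and \<open>L\<close> the graph of \<open>a\<close>,
  then \<open>L \<inter> D\<close> is a copy of the kernel of 1 - a, so the quotient is the size of
  the image of 1 - a.\<close>

definition weight :: "nat \<Rightarrow> ('a ^ 'n) set \<Rightarrow> real" where
  "weight e L = (real (CARD('a) ^ m) / real (card (L \<inter> D))) ^ e"

lemma perp_D: "perp D = D"
proof (rule card_subset_eq[symmetric])
  have "card (perp D) * CARD('a) ^ m = CARD('a) ^ m * CARD('a) ^ m"
    using card_perp[OF subspace_D] by (simp add: dim card_D power_add mult_2)
  then show "card D = card (perp D)"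
    by (simp add: card_D)
qed (use D_isotropic in auto)

text \<open>
  Adjoining a vector of \<open>perp R\<close> to \<open>R\<close> enlarges the intersection with \<open>D\<close> iff the vector lies in
  the following set.
\<close>

definition extension :: "('a ^ 'n) set \<Rightarrow> ('a ^ 'n) set" where
  "extension R = {r + d |r d. r \<in> R \<and> d \<in> D \<inter> perp R}"

text \<open>\<open>extension R\<close> is the usual way to turn \<open>D\<close> into a maximal
  totally isotropic subspace containing \<open>R\<close>. Since \<open>perp D = D\<close>, what
  \<open>D\<close> loses by intersecting with \<open>perp R\<close> is exactly regained by adding
  \<open>R\<close>, whatever \<open>R \<inter> D\<close> is.\<close>

lemma card_extension:
  assumes R: "vec.subspace R" "R \<subseteq> perp R"
  shows "card (extension R) = CARD('a) ^ m"
proof -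
  have pos: "card (R \<inter> D) > 0" "card R > 0"
    using vec.subspace_0[OF R(1)] vec.subspace_0[OF subspace_D] by (auto simp: card_gt_0_iff)
  have "R \<inter> (D \<inter> perp R) = R \<inter> D"
    using R(2) by auto
  then have "card (extension R) * card (R \<inter> D) = card R * card (D \<inter> perp R)"
    using card_subspace_sum[OF R(1) subspace_Int[OF subspace_D subspace_perp[of R]]]
    unfolding extension_def by simp
  also have "\<dots> = CARD('a) ^ m * card (R \<inter> D)"
    using card_Int_perp[OF R(1) subspace_D] by (simp add: perp_D card_D mult.commute)
  finally show ?thesis
    using pos(1) by (auto simp: card_gt_0_iff)
qed

lemma extension_subset:
  assumes R: "vec.subspace R" "R \<subseteq> perp R"
  shows "R \<subseteq> extension R" "extension R \<subseteq> perp R \<inter> isotropic"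
proof -
  show "R \<subseteq> extension R"
  proof
    fix r assume "r \<in> R"
    moreover have "0 \<in> D \<inter> perp R"
      using vec.subspace_0 subspace_D subspace_perp by blast
    ultimately show "r \<in> extension R"
      unfolding extension_def by (metis (mono_tags, lifting) add.right_neutral mem_Collect_eq)
  qed
  show "extension R \<subseteq> perp R \<inter> isotropic"
  proof
    fix x assume "x \<in> extension R"
    then obtain r d where x: "x = r + d" "r \<in> R" "d \<in> D" "d \<in> perp R"
      by (auto simp: extension_def)
    have "B r r = 0" "B d r = 0" "B r d = 0" "B d d = 0"
      using x R(2) D_isotropic B_eq_0_commute[of d r] by (auto simp: perp_def)
    then have "x \<in> isotropic"
      by (simp add: x(1) isotropic_def B_add_left B_add_right)
    moreover have "x \<in> perp R"
      using x R(2) by (auto intro: vec.subspace_add subspace_perp)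
    ultimately show "x \<in> perp R \<inter> isotropic" by simp
  qed
qed

text \<open>Modulo \<open>R\<close> the vector \<open>w = r + d\<close> can be replaced by
  \<open>d\<close>, so the intersection with \<open>D\<close> grows by the line through
  \<open>d\<close>.\<close>

lemma card_span_insert_Int_in_extension:
  assumes R: "vec.subspace R" "R \<subseteq> perp R" and w: "w \<in> extension R" "w \<notin> R"
  shows "card (vec.span (insert w R) \<inter> D) = CARD('a) * card (R \<inter> D)"
proof -
  obtain r d where rd: "w = r + d" "r \<in> R" "d \<in> D"
    using w(1) by (auto simp: extension_def)
  have "d \<notin> R"
    using w(2) rd vec.subspace_add[OF R(1)] by auto
  have RD: "vec.subspace (R \<inter> D)"
    using R(1) subspace_D by (rule subspace_Int)
  have "vec.span (insert w R) \<inter> D = vec.span (insert d (R \<inter> D))"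
  proof (rule Set.set_eqI)
    fix x
    have "x - c *s w \<in> R \<longleftrightarrow> x - c *s d \<in> R" for c
    proof -
      have eq: "x - c *s d = (x - c *s w) + c *s r"
        by (simp add: rd(1) vec.scale_right_distrib)
      show ?thesis
        unfolding eq using R(1) rd(2)
        by (metis add_diff_cancel_right' vec.subspace_add vec.subspace_diff vec.subspace_scale)
    qed
    moreover have "x - c *s d \<in> D \<longleftrightarrow> x \<in> D" for c
      using subspace_D rd(3)
      by (metis diff_add_cancel vec.subspace_add vec.subspace_diff vec.subspace_scale)
    ultimately show "x \<in> vec.span (insert w R) \<inter> D \<longleftrightarrow> x \<in> vec.span (insert d (R \<inter> D))"
      by (auto simp: span_insert_subspace_iff[OF R(1)] span_insert_subspace_iff[OF RD])
  qed
  then show ?thesis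
    using card_span_insert[OF RD, of d] \<open>d \<notin> R\<close> by simp
qed

text \<open>A vector of \<open>D\<close> in the span whose coefficient at \<open>w\<close> is
  nonzero could be solved for \<open>w\<close>, which would place \<open>w\<close> in
  \<open>extension R\<close>.\<close>

lemma card_span_insert_Int_notin_extension:
  assumes R: "vec.subspace R" and w: "w \<in> perp R" "w \<notin> extension R"
    and R_iso: "R \<subseteq> perp R"
  shows "vec.span (insert w R) \<inter> D = R \<inter> D"
proof
  show "R \<inter> D \<subseteq> vec.span (insert w R) \<inter> D"
    by (auto intro: vec.span_base)
  show "vec.span (insert w R) \<inter> D \<subseteq> R \<inter> D"
  proof
    fix x assume x: "x \<in> vec.span (insert w R) \<inter> D"
    then obtain c where c: "x - c *s w \<in> R"
      using span_insert_subspace_iff[OF R] by auto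
    have "c = 0"
    proof (rule ccontr)
      assume "c \<noteq> 0"
      define d where "d = (1 / c) *s x"
      define r where "r = (- 1 / c) *s (x - c *s w)"
      have w_eq: "w = r + d"
        using \<open>c \<noteq> 0\<close> by (simp add: r_def d_def vec.scale_right_diff_distrib)
      have "r \<in> R"
        unfolding r_def by (rule vec.subspace_scale[OF R c])
      moreover have "d \<in> D"
        unfolding d_def using x by (intro vec.subspace_scale[OF subspace_D]) auto
      moreover have "d = w - r"
        by (simp add: w_eq)
      with \<open>r \<in> R\<close> have "d \<in> perp R"
        using \<open>r \<in> R\<close> R_iso w(1) by (auto intro: vec.subspace_diff subspace_perp)
      ultimately have "w \<in> extension R"
        unfolding extension_def using w_eq by blast
      with w(2) show False ..
    qed
    then show "x \<in> R \<inter> D"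
      using c x by simp
  qed
qed

text \<open>The space \<open>perp R\<close> has dimension \<open>2 * m - k\<close> and radical
  \<open>R\<close>, so the sign in \<open>card_isotropic\<close> gets the even exponent
  \<open>2 * m\<close>. The count is arranged as the size of \<open>extension R\<close> plus a
  multiple of the size of \<open>extension R - R\<close>; this common factor later cancels.\<close>

lemma card_perp_isotropic:
  assumes R: "vec.subspace R" "R \<subseteq> perp R" and card_R: "card R = CARD('a) ^ k" and k: "k < m"
  shows "card (perp R \<inter> isotropic) =
    CARD('a) ^ m + q ^ (2 * (m - Suc k) + 1) * (CARD('a) ^ m - CARD('a) ^ k)"
proof -
  have "card (perp R) * CARD('a) ^ k = CARD('a) ^ (2 * m - k) * CARD('a) ^ k"
    using card_perp[OF R(1)] k by (simp add: card_R dim flip: power_add)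
  then have card_perp_R: "card (perp R) = CARD('a) ^ (2 * m - k)"
    by simp
  have rad: "perp R \<inter> perp (perp R) = R"
    using R by (auto simp: perp_perp)
  have "int q * int (card (perp R \<inter> isotropic)) =
      int q ^ (2 * (2 * m - k)) + (int q - 1) * (- int q) ^ (2 * m - k + k)"
    by (rule card_isotropic) (simp_all add: rad card_R card_perp_R subspace_perp)
  also have "2 * m - k + k = 2 * m"
    using k by simp
  also have "int q ^ (2 * (2 * m - k)) + (int q - 1) * (- int q) ^ (2 * m) =
      int q * (int q ^ (2 * m) + int q ^ (2 * (m - Suc k) + 1) * (int q ^ (2 * m) - int q ^ (2 * k)))"
  proof -
    obtain l where "m = Suc k + l"
      using k less_iff_Suc_add by auto
    then show ?thesis
      by (simp add: algebra_simps power_add power2_eq_square)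
        (simp add: mult.commute flip: power_add)
  qed
  finally have "int (card (perp R \<inter> isotropic)) =
      int q ^ (2 * m) + int q ^ (2 * (m - Suc k) + 1) * (int q ^ (2 * m) - int q ^ (2 * k))"
    using q_gt_1 by simp
  also have "\<dots> = int (CARD('a) ^ m + q ^ (2 * (m - Suc k) + 1) * (CARD('a) ^ m - CARD('a) ^ k))"
    using k q_gt_1 by (simp add: card_field of_nat_diff flip: power_mult)
  finally show ?thesis
    by (simp only: of_nat_eq_iff)
qed

lemma totally_isotropic_span_insert:
  assumes R: "vec.subspace R" "R \<subseteq> perp R" and w: "w \<in> perp R" "w \<in> isotropic"
  shows "vec.span (insert w R) \<subseteq> perp (vec.span (insert w R))"
proof (rule vec.span_minimal[OF _ subspace_perp])
  show "insert w R \<subseteq> perp (vec.span (insert w R))"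
    unfolding perp_span using R(2) w B_eq_0_commute by (auto simp: perp_def isotropic_def)
qed

text \<open>Double counting of the pairs of a Lagrangian \<open>L\<close> containing
  \<open>R\<close> and a vector \<open>w\<close> of \<open>L - R\<close>. All \<open>L\<close> have
  equally many such vectors, and all of them are isotropic and orthogonal to
  \<open>R\<close>.\<close>

lemma sum_weight_step:
  assumes R: "vec.subspace R" "R \<subseteq> perp R"
  shows "(real (CARD('a) ^ m) - real (card R)) * (\<Sum>L | lagrangian L \<and> R \<subseteq> L. weight e L) =
    (\<Sum>w\<in>perp R \<inter> isotropic - R. \<Sum>L | lagrangian L \<and> vec.span (insert w R) \<subseteq> L. weight e L)"
proof -
  let ?N = "perp R \<inter> isotropic - R"
  have L_R: "{w \<in> ?N. w \<in> L} = L - R" if "lagrangian L" "R \<subseteq> L" for L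
  proof -
    have "L \<subseteq> perp R \<inter> isotropic"
      using that by (auto simp: lagrangian_def perp_def isotropic_def)
    then show ?thesis by auto
  qed
  have "(real (CARD('a) ^ m) - real (card R)) * (\<Sum>L | lagrangian L \<and> R \<subseteq> L. weight e L) =
      (\<Sum>L | lagrangian L \<and> R \<subseteq> L. \<Sum>w | w \<in> ?N \<and> w \<in> L. weight e L)"
    unfolding sum_distrib_left
  proof (rule sum.cong[OF refl])
    fix L assume "L \<in> {L. lagrangian L \<and> R \<subseteq> L}"
    then have L: "lagrangian L" "R \<subseteq> L" by auto
    have "card (L - R) = CARD('a) ^ m - card R"
      using L by (simp add: card_Diff_subset lagrangian_def)
    moreover have "card R \<le> CARD('a) ^ m"
      using L card_mono[of L R] by (simp add: lagrangian_def)
    ultimately show "(real (CARD('a) ^ m) - real (card R)) * weight e L =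
        (\<Sum>w | w \<in> ?N \<and> w \<in> L. weight e L)"
      by (simp only: L_R[OF L] sum_constant of_nat_diff)
  qed
  also have "\<dots> = (\<Sum>w\<in>?N. \<Sum>L | L \<in> {L. lagrangian L \<and> R \<subseteq> L} \<and> w \<in> L. weight e L)"
    using sum.swap_restrict[of "{L. lagrangian L \<and> R \<subseteq> L}" ?N "\<lambda>L w. weight e L" "\<lambda>L w. w \<in> L"]
    by simp
  also have "\<dots> = (\<Sum>w\<in>?N. \<Sum>L | lagrangian L \<and> vec.span (insert w R) \<subseteq> L. weight e L)"
  proof (intro sum.cong refl)
    fix w
    have "vec.span (insert w R) \<subseteq> L \<longleftrightarrow> insert w R \<subseteq> L" if "lagrangian L" for L
      using that vec.span_superset[of "insert w R"] vec.span_minimal[of "insert w R" L]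
      unfolding lagrangian_def by blast
    then show "{L \<in> {L. lagrangian L \<and> R \<subseteq> L}. w \<in> L} =
        {L. lagrangian L \<and> vec.span (insert w R) \<subseteq> L}"
      by auto
  qed
  finally show ?thesis .
qed

text \<open>Write x for \<open>real (CARD('a) ^ e)\<close>. Adjoining a vector of
  \<open>extension R - R\<close> raises both \<open>k\<close> and \<open>j\<close> and leaves
  \<open>x ^ (k - j)\<close> alone; any other admissible vector raises only \<open>k\<close> and
  costs a factor x. The latter are \<open>q ^ (2 * (m - Suc k) + 1)\<close> times as numerous, which
  is where the new factor of the product comes from.\<close>

lemma sum_weight:
  assumes "vec.subspace R" "R \<subseteq> perp R" "card R = CARD('a) ^ k" "card (R \<inter> D) = CARD('a) ^ j"
    and "k \<le> m"
  shows "(\<Sum>L | lagrangian L \<and> R \<subseteq> L. weight e L) =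
    real (CARD('a) ^ e) ^ (k - j) * (\<Prod>i<m - k. 1 + real (CARD('a) ^ e) * real q ^ (2 * i + 1))"
  using assms
proof (induction "m - k" arbitrary: k j R)
  case 0
  have j: "j \<le> k"
    using card_mono[of R "R \<inter> D"] 0 card_field_gt_1 by (simp add: power_increasing_iff)
  have km: "k = m"
    using 0 by simp
  have "lagrangian R"
    using 0 by (simp add: lagrangian_def km)
  moreover have "L = R" if "lagrangian L" "R \<subseteq> L" for L
    using that 0 card_subset_eq[of L R] by (simp add: lagrangian_def km)
  ultimately have "{L. lagrangian L \<and> R \<subseteq> L} = {R}"
    by blast
  moreover have "weight e R = real (CARD('a) ^ e) ^ (k - j)"
  proof -
    have "real (CARD('a) ^ m) / real (CARD('a) ^ j) = real CARD('a) ^ (m - j)"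
      using j by (simp add: km power_diff)
    then show ?thesis
      using 0 by (simp add: weight_def km mult.commute flip: power_mult)
  qed
  ultimately show ?case
    by (simp add: km)
next
  case (Suc l)
  note R = Suc.prems(1,2)
  have k: "k < m"
    using Suc.hyps(2) by simp
  have j: "j \<le> k"
    using card_mono[of R "R \<inter> D"] Suc.prems card_field_gt_1 by (simp add: power_increasing_iff)
  define x where "x = real (CARD('a) ^ e)"
  define P where "P = (\<Prod>i<m - Suc k. 1 + x * real q ^ (2 * i + 1))"
  define f where "f R = (\<Sum>L | lagrangian L \<and> R \<subseteq> L. weight e L)" for R
  let ?N = "perp R \<inter> isotropic"
  let ?E = "extension R"
  have card_span: "card (vec.span (insert w R)) = CARD('a) ^ Suc k" if "w \<notin> R" for w
    using card_span_insert[OF R(1) that] Suc.prems(3) by simp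
  have E: "R \<subseteq> ?E" "?E \<subseteq> ?N"
    using extension_subset[OF R] by auto
  have 1: "f (vec.span (insert w R)) = x ^ (k - j) * P" if w: "w \<in> ?E - R" for w
  proof -
    have "f (vec.span (insert w R)) = x ^ (Suc k - Suc j) * P"
      unfolding f_def P_def x_def
    proof (rule Suc.hyps(1))
      show "vec.span (insert w R) \<subseteq> perp (vec.span (insert w R))"
        using w E by (intro totally_isotropic_span_insert R) auto
      show "card (vec.span (insert w R) \<inter> D) = CARD('a) ^ Suc j"
        using card_span_insert_Int_in_extension[OF R] w Suc.prems(4) by simp
    qed (use w k card_span Suc.hyps(2) in auto)
    then show ?thesis by simp
  qed
  have 2: "f (vec.span (insert w R)) = x ^ (k - j) * (x * P)" if w: "w \<in> ?N - ?E" for w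
  proof -
    have "f (vec.span (insert w R)) = x ^ (Suc k - j) * P"
      unfolding f_def P_def x_def
    proof (rule Suc.hyps(1))
      show "vec.span (insert w R) \<subseteq> perp (vec.span (insert w R))"
        using w by (intro totally_isotropic_span_insert R) auto
      show "card (vec.span (insert w R) \<inter> D) = CARD('a) ^ j"
        using card_span_insert_Int_notin_extension[OF R(1) _ _ R(2)] w Suc.prems(4) by simp
    qed (use w E k card_span Suc.hyps(2) in auto)
    then show ?thesis
      using j by (simp add: Suc_diff_le)
  qed
  define c where "c = real (CARD('a) ^ m) - real (CARD('a) ^ k)"
  have "real (CARD('a) ^ k) < real (CARD('a) ^ m)"
    using k card_field_gt_1 by (simp del: of_nat_power)
  then have c: "c \<noteq> 0"
    by (simp add: c_def)
  have card_E_R: "real (card (?E - R)) = c"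
    using E card_extension[OF R] Suc.prems(3) card_mono[of ?E R]
    by (simp add: card_Diff_subset c_def of_nat_diff del: of_nat_power)
  have card_N_E: "real (card (?N - ?E)) = real q ^ (2 * (m - Suc k) + 1) * c"
  proof -
    have "card (?N - ?E) = q ^ (2 * (m - Suc k) + 1) * (CARD('a) ^ m - CARD('a) ^ k)"
      using E card_extension[OF R] card_perp_isotropic[OF R Suc.prems(3) k]
      by (simp add: card_Diff_subset)
    moreover have "CARD('a) ^ k \<le> CARD('a) ^ m"
      using k card_field_gt_1 by (simp add: power_increasing)
    ultimately show ?thesis
      by (simp only: c_def of_nat_mult of_nat_diff of_nat_power)
  qed
  have "c * f R = (\<Sum>w\<in>?N - R. f (vec.span (insert w R)))"
    using sum_weight_step[OF R] Suc.prems(3) unfolding f_def c_def by simp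
  also have "?N - R = (?E - R) \<union> (?N - ?E)"
    using E by auto
  also have "(\<Sum>w\<in>(?E - R) \<union> (?N - ?E). f (vec.span (insert w R))) =
      (\<Sum>w\<in>?E - R. f (vec.span (insert w R))) + (\<Sum>w\<in>?N - ?E. f (vec.span (insert w R)))"
    by (rule sum.union_disjoint) auto
  also have "\<dots> = c * (x ^ (k - j) * P) + real q ^ (2 * (m - Suc k) + 1) * c * (x ^ (k - j) * (x * P))"
    by (simp only: 1 2 sum_constant card_E_R card_N_E cong: sum.cong)
  also have "\<dots> = c * (x ^ (k - j) * (P * (1 + x * real q ^ (2 * (m - Suc k) + 1))))"
    by (simp add: algebra_simps)
  also have "P * (1 + x * real q ^ (2 * (m - Suc k) + 1)) =
      (\<Prod>i<m - k. 1 + x * real q ^ (2 * i + 1))"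
  proof -
    have "m - k = Suc (m - Suc k)"
      using k by simp
    then show ?thesis
      by (simp only: P_def prod.lessThan_Suc)
  qed
  finally show ?case
    using c unfolding f_def x_def by simp
qed

end

section \<open>Two hypergeometric sums\<close>

text \<open>The shifted factorial \<open>(a; b)_n\<close> of basic hypergeometric series.\<close>

definition qpoch :: "real \<Rightarrow> real \<Rightarrow> nat \<Rightarrow> real" where
  "qpoch a b n = (\<Prod>i<n. 1 - a * b ^ i)"

lemma qpoch_0 [simp]: "qpoch a b 0 = 1"
  by (simp add: qpoch_def)

lemma qpoch_Suc: "qpoch a b (Suc n) = qpoch a b n * (1 - a * b ^ n)"
  by (simp add: qpoch_def)

lemma qpoch_Suc_shift: "qpoch a b (Suc n) = (1 - a) * qpoch (a * b) b n"
  unfolding qpoch_def by (subst prod.lessThan_Suc_shift) (simp add: mult.assoc)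

text \<open>A free \<open>y\<close> and an arbitrary cut-off \<open>n\<close> make the induction
  work. As a polynomial in \<open>y\<close> of degree \<open>n\<close>, the sum has the roots b,
  ..., b^n and the value 1 at 1.\<close>

lemma sum_qpoch_quotient:
  fixes b y :: real
  assumes "\<And>i. i > 0 \<Longrightarrow> b ^ i \<noteq> 1"
  shows "(\<Sum>k\<le>n. (\<Prod>i<k. y - b ^ i) / qpoch b b k) = (\<Prod>i<n. b ^ Suc i - y) / (\<Prod>i<n. b ^ Suc i - 1)"
proof (induction n)
  case (Suc n)
  have ne: "b ^ Suc i - 1 \<noteq> 0" for i
    using assms[of "Suc i"] by simp
  have minus: "(\<Prod>i<k. - f i) = (- 1) ^ k * (\<Prod>i<k. f i)" for f :: "nat \<Rightarrow> real" and k
    by (induction k) auto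
  have "(\<Prod>i<Suc n. y - b ^ i) = (\<Prod>i<Suc n. - (b ^ i - y))"
    by simp
  also have "\<dots> = (- 1) ^ Suc n * ((1 - y) * (\<Prod>i<n. b ^ Suc i - y))"
    unfolding minus by (subst prod.lessThan_Suc_shift) simp
  finally have 1: "(\<Prod>i<Suc n. y - b ^ i) = (- 1) ^ Suc n * ((1 - y) * (\<Prod>i<n. b ^ Suc i - y))" .
  have "qpoch b b (Suc n) = (\<Prod>i<Suc n. - (b ^ Suc i - 1))"
    by (simp add: qpoch_def)
  then have 2: "qpoch b b (Suc n) = (- 1) ^ Suc n * ((\<Prod>i<n. b ^ Suc i - 1) * (b ^ Suc n - 1))"
    unfolding minus by simp
  have 3: "(\<Prod>i<n. b ^ Suc i - 1) \<noteq> 0"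
    using ne by (simp del: power_Suc)
  have "(\<Prod>i<Suc n. y - b ^ i) / qpoch b b (Suc n) =
      (1 - y) * (\<Prod>i<n. b ^ Suc i - y) / ((\<Prod>i<n. b ^ Suc i - 1) * (b ^ Suc n - 1))"
    unfolding 1 2 by simp
  then show ?case
    using 3 ne[of n]
    by (simp only: sum.atMost_Suc Suc.IH prod.lessThan_Suc) (simp add: field_simps del: power_Suc)
qed simp

text \<open>Moebius inversion on the subspaces of an \<open>r\<close>-dimensional space over a field
  with \<open>b\<close> elements, written with ordered bases. The product counts independent lists
  of length \<open>k\<close>, and \<open>1 / qpoch b b k\<close> is the Moebius value (-1)^k
  b^(k(k-1)/2) of a \<open>k\<close>-dimensional space divided by the number of its ordered
  bases.\<close>

lemma sum_qpoch_quotient_power: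
  fixes b :: real
  assumes b: "\<And>i. i > 0 \<Longrightarrow> b ^ i \<noteq> 1" and "r \<le> n"
  shows "(\<Sum>k\<le>n. (\<Prod>i<k. b ^ r - b ^ i) / qpoch b b k) = (if r = 0 then 1 else 0)"
proof (cases r)
  case 0
  have "(\<Prod>i<n. b ^ Suc i - 1) \<noteq> 0"
    using b by (simp del: power_Suc)
  then show ?thesis
    by (subst sum_qpoch_quotient[OF b]) (simp_all add: 0)
next
  case (Suc s)
  then have "(\<Prod>i<n. b ^ Suc i - b ^ r) = 0"
    using assms(2) by (intro prod_zero) auto
  then show ?thesis
    by (subst sum_qpoch_quotient[OF b]) (simp_all add: Suc)
qed

locale not_root_of_unity =
  fixes p :: real
  assumes power_neq_1: "i > 0 \<Longrightarrow> p ^ i \<noteq> 1"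
begin

lemma qpoch_neq_0:
  "qpoch p p n \<noteq> 0" "qpoch (p\<^sup>2) (p\<^sup>2) n \<noteq> 0"
proof -
  have "1 - p * p ^ i \<noteq> 0" "1 - p\<^sup>2 * (p\<^sup>2) ^ i \<noteq> 0" for i
    using power_neq_1[of "Suc i"] power_neq_1[of "2 * Suc i"]
    by (simp_all only: power_mult power_Suc) auto
  then show "qpoch p p n \<noteq> 0" "qpoch (p\<^sup>2) (p\<^sup>2) n \<noteq> 0"
    by (auto simp: qpoch_def)
qed

text \<open>For \<open>p = - q\<close>, \<open>qpoch p p m * summand e m k\<close> is what the
  totally isotropic lists of length \<open>k\<close> contribute to the sum of the
  \<open>e\<close>-th powers of the image sizes. The default 0 reflects that a totally isotropic
  subspace has at most half the dimension.\<close>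

definition summand :: "nat \<Rightarrow> nat \<Rightarrow> nat \<Rightarrow> real" where
  "summand e m k = (if 2 * k \<le> m then
     (- 1) ^ k * p ^ (k * (k - 1)) * (p ^ (2 * e)) ^ k * qpoch (p ^ (2 * e + 1)) (p\<^sup>2) (m - k) /
       (qpoch p p (m - 2 * k) * qpoch (p\<^sup>2) (p\<^sup>2) k) else 0)"

text \<open>
  The recurrences in \<open>m\<close> for the sums of \<open>summand 0 m k\<close> and of \<open>p ^ (2 * k) * summand 0 m k\<close>
  over \<open>k\<close> hold up to multiples of this term, whose sum over \<open>k\<close> vanishes for \<open>m > 0\<close>. The second sum is
  needed because \<open>(1 - p) * summand 1 m k = (p ^ (2 * k) - p ^ Suc m) * summand 0 (Suc m) k\<close>.
\<close>

definition telescoping_term :: "nat \<Rightarrow> nat \<Rightarrow> real" where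
  "telescoping_term m k = (if 2 * k \<le> Suc m then
     (- 1) ^ k * p ^ (k * (k - 1)) * qpoch p (p\<^sup>2) (m - k) /
       (qpoch p p (Suc m - 2 * k) * qpoch (p\<^sup>2) (p\<^sup>2) k) else 0)"

lemma summand_0_Suc_eq: "summand 0 (Suc m) k = (1 - p ^ (2 * m + 1 - 2 * k)) * telescoping_term m k"
proof (cases "2 * k \<le> Suc m")
  case True
  then have k: "Suc m - k = Suc (m - k)" "2 * m + 1 - 2 * k = Suc (2 * (m - k))"
    by auto
  show ?thesis
    using True unfolding summand_def telescoping_term_def k by (simp add: qpoch_Suc power_mult)
qed (simp add: summand_def telescoping_term_def)

lemma summand_0_eq: "summand 0 m k = (1 - p ^ (Suc m - 2 * k)) * telescoping_term m k"
proof (cases "2 * k \<le> m")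
  case True
  then have k: "Suc m - 2 * k = Suc (m - 2 * k)" by simp
  show ?thesis
    using True qpoch_neq_0 power_neq_1[of "Suc (m - 2 * k)"]
    unfolding summand_def telescoping_term_def k by (simp add: qpoch_Suc field_simps)
next
  case False
  then show ?thesis
    \<comment> \<open>At \<open>2 * k = Suc m\<close> the telescoping term is still present, but its
      factor \<open>1 - p ^ 0\<close> vanishes.\<close>
    by (cases "2 * k = Suc m") (auto simp: summand_def telescoping_term_def)
qed

text \<open>The ratio of consecutive terms, cross-multiplied so that it also holds at and beyond the
  end of the range.\<close>

lemma telescoping_term_Suc:
  "(1 - p ^ (2 * Suc k)) * (1 - p ^ (2 * m + 1 - 2 * Suc k)) * telescoping_term m (Suc k) =
     - (p ^ (2 * k) * (1 - p ^ (Suc m - 2 * k)) * (1 - p ^ (m - 2 * k)) * telescoping_term m k)"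
proof (cases "2 * Suc k \<le> Suc m")
  case True
  then obtain l where m: "m = Suc (2 * k + l)"
    using le_Suc_ex[of "2 * Suc k" "Suc m"] by auto
  have k: "m - k = Suc (k + l)" "m - Suc k = k + l" "Suc m - 2 * k = Suc (Suc l)"
    "Suc m - 2 * Suc k = l" "m - 2 * k = Suc l" "2 * m + 1 - 2 * Suc k = Suc (2 * (k + l))"
    by (simp_all add: m)
  have pow: "Suc k * k = k * (k - 1) + 2 * k"
    by (cases k) auto
  have ne: "1 - p * p ^ l \<noteq> 0" "1 - p * p * p ^ l \<noteq> 0" "1 - p\<^sup>2 * (p\<^sup>2) ^ k \<noteq> 0"
    using power_neq_1[of "Suc l"] power_neq_1[of "Suc (Suc l)"] power_neq_1[of "2 * Suc k"]
    by (simp_all only: power_mult power_Suc mult.assoc) auto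
  define c where "c = (- 1) ^ k * p ^ (k * (k - 1)) * qpoch p (p\<^sup>2) (k + l) /
    (qpoch p p l * qpoch (p\<^sup>2) (p\<^sup>2) k)"
  have "telescoping_term m (Suc k) * (1 - p\<^sup>2 * (p\<^sup>2) ^ k) = - (c * p ^ (2 * k))"
    using True ne by (simp add: telescoping_term_def k pow power_add qpoch_Suc c_def del: mult_Suc mult_Suc_right)
  then have 1: "telescoping_term m (Suc k) * (1 - p ^ (2 * Suc k)) = - (c * p ^ (2 * k))"
    by (simp only: power_mult power_Suc)
  have "telescoping_term m k * ((1 - p * p ^ l) * (1 - p * p * p ^ l)) = c * (1 - p * (p\<^sup>2) ^ (k + l))"
    using True ne by (simp add: telescoping_term_def k qpoch_Suc c_def mult.assoc)
  then have 2: "telescoping_term m k * ((1 - p ^ Suc l) * (1 - p ^ Suc (Suc l))) = c * (1 - p ^ Suc (2 * (k + l)))"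
    by (simp only: power_mult power_Suc mult.assoc)
  have "(1 - p ^ (2 * Suc k)) * (1 - p ^ Suc (2 * (k + l))) * telescoping_term m (Suc k) =
      telescoping_term m (Suc k) * (1 - p ^ (2 * Suc k)) * (1 - p ^ Suc (2 * (k + l)))"
    by (simp only: mult_ac)
  also have "\<dots> = - (p ^ (2 * k) * (telescoping_term m k * ((1 - p ^ Suc l) * (1 - p ^ Suc (Suc l)))))"
    unfolding 1 2 by (simp only: mult_ac minus_mult_left)
  finally show ?thesis
    unfolding k by (simp only: mult_ac)
next
  case False
  then have "telescoping_term m (Suc k) = 0"
    by (simp add: telescoping_term_def)
  \<comment> \<open>In the first two cases one of the factors on the right is
    \<open>1 - p ^ 0\<close>.\<close>
  moreover have "2 * k = m \<or> 2 * k = Suc m \<or> telescoping_term m k = 0"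
    using False by (auto simp: telescoping_term_def)
  ultimately show ?thesis by auto
qed

text \<open>The coefficient of \<open>telescoping_term m k\<close> in the subtracted term is the
  multiplier of a discrete antiderivative. Once the ratio is inserted, the contributions of
  \<open>p ^ (2 * k)\<close> and \<open>p ^ (2 * m + 1 - 2 * k)\<close> cancel, and the remaining
  coefficient is independent of \<open>k\<close>.\<close>

lemma telescoping_term_telescope:
  "(1 - p ^ (2 * Suc k)) * (1 - p ^ (2 * m + 1 - 2 * Suc k)) * telescoping_term m (Suc k) -
     (1 - p ^ (2 * k)) * (1 - p ^ (2 * m + 1 - 2 * k)) * telescoping_term m k =
   - ((1 - p ^ m) * (1 - p ^ Suc m) * telescoping_term m k)"
proof (cases "2 * k \<le> m")
  case True
  then obtain l where m: "m = 2 * k + l"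
    using le_Suc_ex by blast
  have k: "Suc m - 2 * k = Suc l" "m - 2 * k = l" "2 * m + 1 - 2 * k = Suc (2 * k + 2 * l)"
    by (simp_all add: m)
  show ?thesis
    unfolding telescoping_term_Suc k unfolding m
    by (simp add: algebra_simps power_add power_mult power2_eq_square power_mult_distrib)
next
  case False
  show ?thesis
  proof (cases "2 * k = Suc m")
    case True
    then have k: "Suc m - 2 * k = 0" "2 * m + 1 - 2 * k = m"
      by simp_all
    show ?thesis
      unfolding telescoping_term_Suc k True by simp
  next
    case False
    then have "telescoping_term m k = 0"
      using \<open>\<not> 2 * k \<le> m\<close> by (simp add: telescoping_term_def)
    then show ?thesis
      unfolding telescoping_term_Suc by simp
  qed
qed

text \<open>Both ends of the telescope vanish: the lower one by its factor \<open>1 - p ^ 0\<close>,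
  the upper one because it lies outside the range. The factor \<open>1 - p ^ m\<close> stays so that
  \<open>m = 0\<close> is included, where the sum is 1 / (1 - p). The bound \<open>N\<close> is
  separate from \<open>m\<close> so that inductions on \<open>m\<close> can keep it fixed.\<close>

lemma sum_telescoping_term:
  assumes "m \<le> N"
  shows "(1 - p ^ m) * (\<Sum>k\<le>N. telescoping_term m k) = 0"
proof -
  define G where "G k = (1 - p ^ (2 * k)) * (1 - p ^ (2 * m + 1 - 2 * k)) * telescoping_term m k" for k
  have "- ((1 - p ^ m) * (1 - p ^ Suc m) * (\<Sum>k\<le>N. telescoping_term m k)) = (\<Sum>k\<le>N. G (Suc k) - G k)"
    unfolding G_def telescoping_term_telescope by (simp add: sum_distrib_left sum_negf)
  also have "\<dots> = G (Suc N) - G 0"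
    using sum_telescope[of "\<lambda>k. - G k" N] by simp
  also have "\<dots> = 0"
    using assms by (simp add: G_def telescoping_term_def)
  finally show ?thesis
    using power_neq_1[of "Suc m"] by simp
qed

text \<open>Up to the telescoping part, going from \<open>m\<close> to \<open>Suc m\<close>
  multiplies the sum by \<open>p ^ m\<close>, so the exponents 0, ..., m - 1 accumulate.\<close>

lemma sum_summand_0:
  "m \<le> N \<Longrightarrow> (\<Sum>k\<le>N. summand 0 m k) = p ^ (m * (m - 1) div 2)"
proof (induction m)
  case 0
  have "summand 0 0 k = (if k = 0 then 1 else 0)" for k
    by (simp add: summand_def)
  then show ?case by simp
next
  case (Suc m)
  have "summand 0 (Suc m) k = p ^ m * summand 0 m k + (1 - p ^ m) * telescoping_term m k" for k
  proof (cases "2 * k \<le> Suc m")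
    case True
    then have "2 * m + 1 - 2 * k = m + (Suc m - 2 * k)"
      by simp
    then have "p ^ (2 * m + 1 - 2 * k) = p ^ m * p ^ (Suc m - 2 * k)"
      by (simp only: power_add)
    then show ?thesis
      unfolding summand_0_Suc_eq summand_0_eq[of m] by (simp add: algebra_simps)
  qed (simp add: summand_def telescoping_term_def)
  then have "(\<Sum>k\<le>N. summand 0 (Suc m) k) =
      p ^ m * (\<Sum>k\<le>N. summand 0 m k) + (1 - p ^ m) * (\<Sum>k\<le>N. telescoping_term m k)"
    by (simp add: sum.distrib sum_distrib_left)
  also have "\<dots> = p ^ (m + m * (m - 1) div 2)"
    using Suc sum_telescoping_term[of m N] by (simp add: power_add)
  also have "m + m * (m - 1) div 2 = Suc m * (Suc m - 1) div 2"
    by (cases m) (auto simp: algebra_simps)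
  finally show ?case .
qed

text \<open>The extra weight \<open>p ^ (2 * k)\<close> changes the factor \<open>p ^ m\<close> of
  the previous recurrence into 1, so the sum does not depend on \<open>m\<close>.\<close>

lemma sum_power_summand_0:
  "m \<le> N \<Longrightarrow> (\<Sum>k\<le>N. p ^ (2 * k) * summand 0 m k) = 1"
proof (induction m)
  case 0
  have "p ^ (2 * k) * summand 0 0 k = (if k = 0 then 1 else 0)" for k
    by (simp add: summand_def)
  then show ?case by simp
next
  case (Suc m)
  have "p ^ (2 * k) * summand 0 (Suc m) k =
      p ^ (2 * k) * summand 0 m k + p ^ Suc m * ((1 - p ^ m) * telescoping_term m k)" for k
  proof (cases "2 * k \<le> Suc m")
    case True
    then have "p ^ (2 * k) * p ^ (2 * m + 1 - 2 * k) = p ^ Suc m * p ^ m"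
      "p ^ (2 * k) * p ^ (Suc m - 2 * k) = p ^ Suc m"
      unfolding power_add[symmetric] by (auto intro: arg_cong[where f = "power p"])
    moreover have "p ^ (2 * k) * ((1 - x) * a) = p ^ (2 * k) * a - p ^ (2 * k) * x * a" for x a
      by (simp add: algebra_simps)
    ultimately show ?thesis
      unfolding summand_0_Suc_eq summand_0_eq[of m] by (simp add: algebra_simps del: power_Suc)
  qed (simp add: summand_def telescoping_term_def)
  then have "(\<Sum>k\<le>N. p ^ (2 * k) * summand 0 (Suc m) k) =
      (\<Sum>k\<le>N. p ^ (2 * k) * summand 0 m k) + p ^ Suc m * ((1 - p ^ m) * (\<Sum>k\<le>N. telescoping_term m k))"
    by (simp add: sum.distrib sum_distrib_left del: power_Suc)
  then show ?case
    using Suc sum_telescoping_term[of m N] by simp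
qed

lemma sum_summand_1:
  "(1 - p) * (\<Sum>k\<le>m. summand 1 m k) = 1 - p ^ ((m + 1) * (m + 2) div 2)"
proof -
  have "(1 - p) * summand 1 m k = p ^ (2 * k) * summand 0 (Suc m) k - p ^ Suc m * summand 0 (Suc m) k" for k
  proof (cases "2 * k \<le> m")
    case True
    then obtain l where m: "m = 2 * k + l"
      using le_Suc_ex by blast
    have k: "Suc m - 2 * k = Suc l" "m - 2 * k = l" "m - k = k + l" "Suc m - k = Suc (k + l)"
      by (simp_all add: m)
    have ne: "1 - p * p ^ l \<noteq> 0"
      using power_neq_1[of "Suc l"] by simp
    define c where "c = (- 1) ^ k * p ^ (k * (k - 1)) * qpoch (p * p\<^sup>2) (p\<^sup>2) (k + l) /
      (qpoch p p l * qpoch (p\<^sup>2) (p\<^sup>2) k)"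
    have "p ^ (2 * 1 + 1) = p * p\<^sup>2" "(p ^ (2 * 1)) ^ k = p ^ (2 * k)"
      by (simp_all add: power3_eq_cube power2_eq_square power_mult)
    then have "summand 1 m k = c * p ^ (2 * k)"
      using True unfolding summand_def k c_def by simp
    \<comment> \<open>\<open>qpoch (p * p\<^sup>2) (p\<^sup>2) (k + l)\<close> is
      \<open>qpoch p (p\<^sup>2) (Suc (k + l))\<close> without its first factor
      \<open>1 - p\<close>; this is where the dimension rises by one.\<close>
    moreover have "summand 0 (Suc m) k * (1 - p * p ^ l) = c * (1 - p)"
      using True ne unfolding summand_def k c_def
      by (simp add: qpoch_Suc[of p p] qpoch_Suc_shift[of p "p\<^sup>2"] mult_ac)
    moreover have "p ^ (2 * k) * summand 0 (Suc m) k - p ^ Suc m * summand 0 (Suc m) k =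
        p ^ (2 * k) * (summand 0 (Suc m) k * (1 - p * p ^ l))"
      by (simp add: m power_add algebra_simps)
    ultimately show ?thesis
      by (simp only: mult_ac)
  next
    case False
    then show ?thesis
      \<comment> \<open>At \<open>2 * k = Suc m\<close> the left side is 0 by default, the right
        side because its two powers of \<open>p\<close> coincide.\<close>
      by (cases "2 * k = Suc m") (auto simp: summand_def)
  qed
  then have "(1 - p) * (\<Sum>k\<le>Suc m. summand 1 m k) =
      (\<Sum>k\<le>Suc m. p ^ (2 * k) * summand 0 (Suc m) k) - p ^ Suc m * (\<Sum>k\<le>Suc m. summand 0 (Suc m) k)"
    by (simp only: sum_distrib_left sum_subtractf)
  also have "\<dots> = 1 - p ^ (Suc m + Suc m * (Suc m - 1) div 2)"
    unfolding sum_power_summand_0[OF order.refl] sum_summand_0[OF order.refl] by (simp add: power_add)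
  also have "Suc m + Suc m * (Suc m - 1) div 2 = (m + 1) * (m + 2) div 2"
    by (auto simp: algebra_simps)
  finally show ?thesis
    by (simp add: summand_def)
qed

end

section \<open>Totally isotropic subspaces\<close>

lemma card_lists_Suc:
  fixes P :: "'b::finite list \<Rightarrow> bool"
  assumes "\<And>x xs. P (x # xs) \<Longrightarrow> P xs"
    and "\<And>xs. length xs = k \<Longrightarrow> P xs \<Longrightarrow> real (card {x. P (x # xs)}) = c"
  shows "real (card {xs. length xs = Suc k \<and> P xs}) = real (card {xs. length xs = k \<and> P xs}) * c"
proof -
  let ?A = "SIGMA xs : {xs. length xs = k \<and> P xs}. {x. P (x # xs)}"
  have fin: "finite {xs. length xs = k \<and> P xs}"
    using finite_lists_length_eq[of "UNIV :: 'b set" k] by (rule finite_subset[rotated]) auto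
  have "{xs. length xs = Suc k \<and> P xs} = (\<lambda>(xs, x). x # xs) ` ?A"
    using assms(1) by (auto simp: length_Suc_conv image_iff)
  moreover have "inj_on (\<lambda>(xs, x). x # xs) ?A"
    by (auto simp: inj_on_def)
  ultimately have "card {xs. length xs = Suc k \<and> P xs} = card ?A"
    by (simp add: card_image)
  also have "real (card ?A) = (\<Sum>xs | length xs = k \<and> P xs. real (card {x. P (x # xs)}))"
    using fin by (subst card_SigmaI) auto
  also have "\<dots> = real (card {xs. length xs = k \<and> P xs}) * c"
    using assms(2) by simp
  finally show ?thesis .
qed

text \<open>Ordered independent lists stand in for subspaces: every \<open>k\<close>-dimensional
  subspace is listed equally often, and the lists are counted one vector at a time as plain
  products.\<close>

fun indep :: "('a::field ^ 'n::finite) list \<Rightarrow> bool" where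
  "indep [] \<longleftrightarrow> True"
| "indep (x # xs) \<longleftrightarrow> x \<notin> vec.span (set xs) \<and> indep xs"

lemma card_span_indep:
  fixes xs :: "('a::{field,finite} ^ 'n::finite) list"
  assumes "indep xs"
  shows "card (vec.span (set xs)) = CARD('a) ^ length xs"
  using assms
proof (induction xs)
  case (Cons x xs)
  have "vec.span (insert x (vec.span (set xs))) = vec.span (insert x (set xs))"
    by (auto simp: vec.span_breakdown_eq vec.span_span)
  then show ?case
    using Cons card_span_insert[of "vec.span (set xs)" x] by simp
qed simp

lemma card_indep_lists:
  fixes X :: "('a::{field,finite} ^ 'n::finite) set"
  assumes X: "vec.subspace X"
  shows "real (card {xs. length xs = k \<and> indep xs \<and> set xs \<subseteq> X}) =
    (\<Prod>i<k. real (card X) - real CARD('a) ^ i)"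
proof (induction k)
  case 0
  have "{xs. length xs = 0 \<and> indep xs \<and> set xs \<subseteq> X} = {[]}" by auto
  then show ?case by simp
next
  case (Suc k)
  have "real (card {xs. length xs = Suc k \<and> indep xs \<and> set xs \<subseteq> X}) =
      real (card {xs. length xs = k \<and> indep xs \<and> set xs \<subseteq> X}) * (real (card X) - real CARD('a) ^ k)"
  proof (rule card_lists_Suc)
    fix xs :: "('a ^ 'n) list"
    assume xs: "length xs = k" "indep xs \<and> set xs \<subseteq> X"
    then have "vec.span (set xs) \<subseteq> X"
      using X by (intro vec.span_minimal) auto
    moreover have "{x. indep (x # xs) \<and> set (x # xs) \<subseteq> X} = X - vec.span (set xs)"
      using xs by auto
    ultimately show "real (card {x. indep (x # xs) \<and> set (x # xs) \<subseteq> X}) =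
        real (card X) - real CARD('a) ^ k"
      using card_span_indep[of xs] xs card_mono[of X "vec.span (set xs)"]
      by (simp add: card_Diff_subset of_nat_diff)
  qed auto
  then show ?case
    by (simp add: Suc.IH)
qed

context hermitian_space
begin

definition isotropic_lists :: "nat \<Rightarrow> ('a ^ 'n) list set" where
  "isotropic_lists k = {xs. length xs = k \<and> indep xs \<and> set xs \<subseteq> perp (set xs)}"

lemma totally_isotropic_span:
  "S \<subseteq> perp S \<Longrightarrow> vec.span S \<subseteq> perp (vec.span S)"
  by (intro vec.span_minimal subspace_perp) (simp add: perp_span)

lemma card_totally_isotropic_le:
  assumes R: "vec.subspace R" "R \<subseteq> perp R" "card R = CARD('a) ^ k"
  shows "2 * k \<le> CARD('n)"
proof -
  have "CARD('a) ^ (2 * k) = card R * card R"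
    by (simp add: R(3) mult_2 power_add)
  also have "\<dots> \<le> card (perp R) * card R"
    using R(2) by (simp add: card_mono)
  also have "\<dots> = CARD('a) ^ CARD('n)"
    by (rule card_perp[OF R(1)])
  finally show ?thesis
    using card_field_gt_1 by (simp add: power_increasing_iff)
qed

lemma isotropic_lists_le: "xs \<in> isotropic_lists k \<Longrightarrow> 2 * k \<le> CARD('n)"
  using card_totally_isotropic_le[of "vec.span (set xs)" k] totally_isotropic_span[of "set xs"]
    card_span_indep[of xs]
  by (auto simp: isotropic_lists_def)

sublocale not_root_of_unity "- real q"
proof
  fix i :: nat assume "i > 0"
  then have "\<bar>(- real q) ^ i\<bar> > 1"
    using q_gt_1 by (simp add: power_abs one_less_power)
  then show "(- real q) ^ i \<noteq> 1"
    by (metis abs_one less_irrefl)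
qed

text \<open>If \<open>R\<close> is the span of the list so far, the next vector is an isotropic
  vector of \<open>perp R\<close> outside \<open>R\<close>. In terms of \<open>p\<close> the number
  of choices is \<open>- (p ^ (2 * k))\<close> times the last two factors of
  \<open>qpoch p p (CARD('n) - 2 * k)\<close>, so the product over the steps collapses to a
  quotient.\<close>

lemma card_isotropic_lists:
  defines "p \<equiv> - real q"
  shows "real (card (isotropic_lists k)) =
    (if 2 * k \<le> CARD('n)
     then (- 1) ^ k * p ^ (k * (k - 1)) * qpoch p p CARD('n) / qpoch p p (CARD('n) - 2 * k) else 0)"
proof (induction k)
  case 0
  have "isotropic_lists 0 = {[]}"
    by (auto simp: isotropic_lists_def)
  then show ?case
    using qpoch_neq_0 by (simp add: p_def)
next
  case (Suc k)
  show ?case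
  proof (cases "2 * Suc k \<le> CARD('n)")
    case True
    then obtain l where l: "CARD('n) = Suc (Suc (2 * k + l))"
      using le_Suc_ex[of "2 * Suc k" "CARD('n)"] by auto
    have "real (card (isotropic_lists (Suc k))) = real (card (isotropic_lists k)) *
        (- (p ^ (2 * k) * (1 - p ^ Suc l) * (1 - p ^ Suc (Suc l))))"
      unfolding isotropic_lists_def
    proof (rule card_lists_Suc)
      fix x :: "'a ^ 'n" and xs
      assume "indep (x # xs) \<and> set (x # xs) \<subseteq> perp (set (x # xs))"
      then show "indep xs \<and> set xs \<subseteq> perp (set xs)"
        by (auto simp: perp_def)
    next
      fix xs :: "('a ^ 'n) list"
      assume xs: "length xs = k" "indep xs \<and> set xs \<subseteq> perp (set xs)"
      define R where "R = vec.span (set xs)"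
      have R: "vec.subspace R" "R \<subseteq> perp R" "card R = CARD('a) ^ k"
        using xs totally_isotropic_span card_span_indep[of xs] by (simp_all add: R_def)
      have "card (perp R) * CARD('a) ^ k = CARD('a) ^ (CARD('n) - k) * CARD('a) ^ k"
        using card_perp[OF R(1)] True by (simp add: R(3) flip: power_add)
      then have card_perp_R: "card (perp R) = CARD('a) ^ (CARD('n) - k)"
        by simp
      have rad: "perp R \<inter> perp (perp R) = R"
        using R by (auto simp: perp_perp)
      have "int q * int (card (perp R \<inter> isotropic)) =
          int q ^ (2 * (CARD('n) - k)) + (int q - 1) * (- int q) ^ (CARD('n) - k + k)"
        by (rule card_isotropic) (simp_all add: rad R(3) card_perp_R subspace_perp)
      from arg_cong[where f = real_of_int, OF this]
      have "real q * real (card (perp R \<inter> isotropic)) =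
          real q ^ (2 * (CARD('n) - k)) + (real q - 1) * p ^ (CARD('n) - k + k)"
        by (simp add: p_def)
      also have "CARD('n) - k + k = 2 * k + l + 2"
        using l by simp
      also have "2 * (CARD('n) - k) = 2 * (k + l + 2)"
        using l by simp
      also have "real q ^ (2 * (k + l + 2)) = p ^ (2 * (k + l + 2))"
        by (simp add: p_def del: mult_Suc_right)
      also have "real q = - p"
        by (simp add: p_def)
      finally have N: "- p * real (card (perp R \<inter> isotropic)) =
          p ^ (2 * (k + l + 2)) + (- p - 1) * p ^ (2 * k + l + 2)" .
      have set_eq: "{x. indep (x # xs) \<and> set (x # xs) \<subseteq> perp (set (x # xs))} = perp R \<inter> isotropic - R"
        unfolding R_def perp_span using xs B_eq_0_commute by (auto simp: perp_def isotropic_def)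
      have "R \<subseteq> perp R \<inter> isotropic"
        using R(2) by (auto simp: perp_def isotropic_def)
      then have "card (perp R \<inter> isotropic - R) = card (perp R \<inter> isotropic) - CARD('a) ^ k"
        "CARD('a) ^ k \<le> card (perp R \<inter> isotropic)"
        using R(3) card_mono[of "perp R \<inter> isotropic" R] by (simp_all add: card_Diff_subset)
      then have "real (card (perp R \<inter> isotropic - R)) =
          real (card (perp R \<inter> isotropic)) - real (CARD('a) ^ k)"
        by (simp only: of_nat_diff)
      also have "real (CARD('a) ^ k) = p ^ (2 * k)"
        by (simp add: card_field p_def flip: power_mult)
      finally have "- p * real (card (perp R \<inter> isotropic - R)) =
          - p * real (card (perp R \<inter> isotropic)) + p * p ^ (2 * k)"
        by (simp only: right_diff_distrib)
      also have "\<dots> = p ^ (2 * (k + l + 2)) + (- p - 1) * p ^ (2 * k + l + 2) + p * p ^ (2 * k)"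
        by (simp only: N)
      also have "\<dots> = - p * (- (p ^ (2 * k) * (1 - p ^ Suc l) * (1 - p ^ Suc (Suc l))))"
        by (simp add: algebra_simps power_add power_mult power2_eq_square power_mult_distrib)
      finally have eq: "- p * real (card (perp R \<inter> isotropic - R)) =
          - p * (- (p ^ (2 * k) * (1 - p ^ Suc l) * (1 - p ^ Suc (Suc l))))" .
      have "- p \<noteq> 0"
        using q_gt_1 by (simp add: p_def)
      from mult_left_cancel[OF this, THEN iffD1, OF eq]
      show "real (card {x. indep (x # xs) \<and> set (x # xs) \<subseteq> perp (set (x # xs))}) =
          - (p ^ (2 * k) * (1 - p ^ Suc l) * (1 - p ^ Suc (Suc l)))"
        unfolding set_eq .
    qed
    moreover have "qpoch p p (Suc (Suc l)) = qpoch p p l * (1 - p ^ Suc l) * (1 - p ^ Suc (Suc l))"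
      by (simp add: qpoch_Suc)
    moreover have "p ^ (Suc k * (Suc k - 1)) = p ^ (k * (k - 1)) * p ^ (2 * k)"
    proof -
      have "Suc k * (Suc k - 1) = k * (k - 1) + 2 * k"
        by (cases k) auto
      then show ?thesis
        by (simp only: power_add)
    qed
    moreover have "CARD('n) - 2 * k = Suc (Suc l)" "CARD('n) - 2 * Suc k = l" "2 * k \<le> CARD('n)"
      using l by simp_all
    moreover have "1 - p ^ Suc l \<noteq> 0" "1 - p ^ Suc (Suc l) \<noteq> 0" "qpoch p p l \<noteq> 0"
      using power_neq_1[of "Suc l"] power_neq_1[of "Suc (Suc l)"] qpoch_neq_0 unfolding p_def by simp_all
    ultimately show ?thesis
      using True Suc.IH by (simp only: if_True) (simp del: power_Suc add: power_Suc[of "- 1"])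
  next
    case False
    then have "isotropic_lists (Suc k) = {}"
      using isotropic_lists_le by blast
    then show ?thesis
      using False by simp
  qed
qed

end

section \<open>Graphs of isometries\<close>

text \<open>Indexing by a sum type makes the direct sum of two copies of V a space of the same
  shape, so the theory of Hermitian spaces applies to it unchanged.\<close>

definition vec_pair :: "'a ^ 'n \<Rightarrow> 'a ^ 'n \<Rightarrow> 'a ^ ('n::finite + 'n)" where
  "vec_pair x y = (\<chi> i. case i of Inl j \<Rightarrow> x $ j | Inr j \<Rightarrow> y $ j)"

definition vec_fst :: "'a ^ ('n::finite + 'n) \<Rightarrow> 'a ^ 'n" where
  "vec_fst v = (\<chi> j. v $ Inl j)"

definition vec_snd :: "'a ^ ('n::finite + 'n) \<Rightarrow> 'a ^ 'n" where
  "vec_snd v = (\<chi> j. v $ Inr j)"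

lemma vec_fst_pair [simp]: "vec_fst (vec_pair x y) = x"
  and vec_snd_pair [simp]: "vec_snd (vec_pair x y) = y"
  and vec_pair_fst_snd [simp]: "vec_pair (vec_fst v) (vec_snd v) = v"
  by (auto simp: vec_fst_def vec_snd_def vec_pair_def vec_eq_iff split: sum.split)

lemma vec_pair_eq_iff [simp]: "vec_pair x y = vec_pair x' y' \<longleftrightarrow> x = x' \<and> y = y'"
  by (metis vec_fst_pair vec_snd_pair)

lemma vec_pair_add: "vec_pair x y + vec_pair x' y' = vec_pair (x + x') (y + y')"
  and vec_pair_scale: "c *s vec_pair x y = vec_pair (c *s x) (c *s y)"
  and vec_pair_0: "vec_pair 0 0 = 0"
  by (auto simp: vec_pair_def vec_eq_iff split: sum.split)

lemma vec_fst_linear: "vec_fst (u + v) = vec_fst u + vec_fst v" "vec_fst (c *s v) = c *s vec_fst v"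
  and vec_snd_linear: "vec_snd (u + v) = vec_snd u + vec_snd v" "vec_snd (c *s v) = c *s vec_snd v"
  by (auto simp: vec_fst_def vec_snd_def vec_eq_iff)

lemma subspace_vertical:
  assumes "vec.subspace L"
  shows "vec.subspace {y. vec_pair 0 y \<in> L}"
proof -
  have "vec_pair 0 (x + y) = vec_pair 0 x + vec_pair 0 y" "vec_pair 0 (c *s x) = c *s vec_pair 0 x"
    for c :: 'a and x y :: "'a ^ 'b"
    by (simp_all add: vec_pair_add vec_pair_scale)
  then show ?thesis
    using assms by (simp add: vec.subspace_def vec_pair_0)
qed

lemma card_range_kernel:
  fixes f :: "'b::{ab_group_add,finite} \<Rightarrow> 'c::ab_group_add"
  assumes add: "\<And>x y. f (x + y) = f x + f y"
  shows "CARD('b) = card (range f) * card {x. f x = 0}"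
proof -
  have diff: "f (x - y) = f x - f y" for x y
    using add[of "x - y" y] by simp
  have fibre: "card {x. f x = y} = card {x. f x = 0}" if "y \<in> range f" for y
  proof -
    from that obtain z where "y = f z" by blast
    then have "bij_betw (\<lambda>x. z + x) {x. f x = 0} {x. f x = y}"
      by (intro bij_betw_byWitness[where f' = "\<lambda>x. x - z"]) (auto simp: add diff)
    from bij_betw_same_card[OF this] show ?thesis
      by simp
  qed
  have "CARD('b) = card (\<Union>y\<in>range f. {x. f x = y})"
    by (rule arg_cong[where f = card]) auto
  also have "\<dots> = (\<Sum>y\<in>range f. card {x. f x = y})"
    by (rule card_UN_disjoint) auto
  also have "\<dots> = card (range f) * card {x. f x = 0}"
    using fibre by simp
  finally show ?thesis .
qed

lemma vector_matrix_mult_eqI: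
  fixes a b :: "'a::field ^ 'n::finite ^ 'n"
  assumes "\<And>x. x v* a = x v* b"
  shows "a = b"
proof -
  have "axis i 1 v* c = c $ i" for i and c :: "'a ^ 'n ^ 'n"
    by (simp add: vec_eq_iff vector_matrix_mult_def axis_def if_distrib if_distribR cong: if_cong)
  then show ?thesis
    using assms by (metis vec_eq_iff)
qed

definition doubled_form :: "('a ^ 'n \<Rightarrow> 'a ^ 'n \<Rightarrow> 'a) \<Rightarrow> 'a::ab_group_add ^ ('n::finite + 'n) \<Rightarrow> 'a ^ ('n + 'n) \<Rightarrow> 'a" where
  "doubled_form B u v = B (vec_fst u) (vec_fst v) - B (vec_snd u) (vec_snd v)"

definition diagonal :: "('a ^ ('n::finite + 'n)) set" where
  "diagonal = range (\<lambda>x. vec_pair x x)"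

definition graph :: "'a::semiring_1 ^ 'n ^ 'n \<Rightarrow> ('a ^ ('n::finite + 'n)) set" where
  "graph a = range (\<lambda>x. vec_pair x (x v* a))"

definition displacements :: "'a::ring_1 ^ 'n ^ 'n \<Rightarrow> ('a ^ 'n::finite) set" where
  "displacements a = range (\<lambda>u. u - u v* a)"

context hermitian_space
begin

lemma split_hermitian_space_doubled:
  "split_hermitian_space q (doubled_form B) CARD('n) diagonal"
proof -
  interpret double: hermitian_space q "doubled_form B"
  proof
    show "hermitian_form q (doubled_form B)"
      unfolding hermitian_form_def doubled_form_def
      by (auto simp: vec_fst_linear vec_snd_linear B_add_left B_scale_left diff_power_q
          algebra_simps simp flip: B_conj)
    show "nondegenerate (doubled_form B)"
      unfolding nondegenerate_def
    proof (intro allI impI)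
      fix u :: "'a ^ ('n + 'n)"
      assume *: "\<forall>v. doubled_form B u v = 0"
      have "vec_fst u = 0"
        using *[rule_format, of "vec_pair v 0" for v]
        by (intro eq_0_if_orthogonal) (simp add: doubled_form_def B_zero_right)
      moreover have "vec_snd u = 0"
        using *[rule_format, of "vec_pair 0 v" for v]
        by (intro eq_0_if_orthogonal) (simp add: doubled_form_def B_zero_right)
      ultimately show "u = 0"
        by (metis vec_pair_fst_snd vec_pair_0)
    qed
  qed
  show ?thesis
  proof
    show "CARD('n + 'n) = 2 * CARD('n)"
      by simp
    let ?D = "diagonal :: ('a ^ ('n + 'n)) set"
    show "vec.subspace ?D"
      unfolding vec.subspace_def diagonal_def
      by (auto simp: vec_pair_add vec_pair_scale simp flip: vec_pair_0)
    show "?D \<subseteq> double.perp ?D"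
      by (auto simp: diagonal_def double.perp_def doubled_form_def)
    show "card ?D = CARD('a) ^ CARD('n)"
      unfolding diagonal_def by (subst card_image) (auto simp: inj_on_def)
  qed
qed

interpretation double: split_hermitian_space q "doubled_form B" "CARD('n)" diagonal
  by (rule split_hermitian_space_doubled)

lemma lagrangian_graph:
  assumes a: "a \<in> unitary_group B"
  shows "double.lagrangian (graph a)"
  unfolding double.lagrangian_def
proof (intro conjI)
  show "vec.subspace (graph a)"
    unfolding vec.subspace_def graph_def
  proof (intro conjI ballI allI; clarify?)
    show "0 \<in> range (\<lambda>x. vec_pair x (x v* a))"
      by (rule range_eqI[of _ _ 0]) (simp add: vec_pair_0)
    fix x y
    show "vec_pair x (x v* a) + vec_pair y (y v* a) \<in> range (\<lambda>x. vec_pair x (x v* a))"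
      by (rule range_eqI[of _ _ "x + y"]) (simp add: vec_pair_add vector_matrix_left_distrib)
    fix c
    show "c *s vec_pair x (x v* a) \<in> range (\<lambda>x. vec_pair x (x v* a))"
      by (rule range_eqI[of _ _ "c *s x"]) (simp add: vec_pair_scale scalar_vector_matrix_assoc)
  qed
  show "graph a \<subseteq> double.perp (graph a)"
    using a by (auto simp: graph_def double.perp_def doubled_form_def unitary_group_def)
  show "card (graph a) = CARD('a) ^ CARD('n)"
    unfolding graph_def by (subst card_image) (auto simp: inj_on_def)
qed

text \<open>The first projection is injective on \<open>L\<close> and, by cardinality, onto, so
  \<open>L\<close> is the graph of a function. Uniqueness of the second component makes it linear,
  isotropy of \<open>L\<close> makes it an isometry, and nondegeneracy makes it invertible.\<close>

lemma lagrangian_is_graph: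
  assumes L: "double.lagrangian L" and vertical: "\<And>y. vec_pair 0 y \<in> L \<Longrightarrow> y = 0"
  shows "\<exists>a\<in>unitary_group B. L = graph a"
proof -
  have sub: "vec.subspace L" and iso: "L \<subseteq> double.perp L" and card_L: "card L = CARD('a) ^ CARD('n)"
    using L by (auto simp: double.lagrangian_def)
  have unique: "y = y'" if "vec_pair x y \<in> L" "vec_pair x y' \<in> L" for x y y'
  proof -
    have "vec_pair x y - vec_pair x y' \<in> L"
      using sub that by (rule vec.subspace_diff)
    moreover have "vec_pair x y = vec_pair 0 (y - y') + vec_pair x y'"
      by (simp add: vec_pair_add)
    ultimately have "vec_pair 0 (y - y') \<in> L" by simp
    then show ?thesis
      using vertical by force
  qed
  have "inj_on vec_fst L"
    by (rule inj_onI) (metis unique vec_pair_fst_snd)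
  then have "vec_fst ` L = UNIV"
    using card_L by (intro card_subset_eq) (auto simp: card_image)
  have "\<exists>y. vec_pair x y \<in> L" for x
  proof -
    have "x \<in> vec_fst ` L"
      using \<open>vec_fst ` L = UNIV\<close> by simp
    then obtain v where "v \<in> L" "x = vec_fst v"
      by blast
    then have "vec_pair x (vec_snd v) \<in> L"
      by simp
    then show ?thesis ..
  qed
  then obtain f where f: "\<And>x. vec_pair x (f x) \<in> L"
    by metis
  have linear: "Vector_Spaces.linear (*s) (*s) f"
    unfolding Vector_Spaces.linear_iff
  proof (intro conjI allI vec.vector_space_axioms)
    fix x y c
    show "f (x + y) = f x + f y"
      using vec.subspace_add[OF sub f[of x] f[of y]] by (intro unique[OF f]) (simp add: vec_pair_add)
    show "f (c *s x) = c *s f x"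
      using vec.subspace_scale[OF sub f[of x], of c] by (intro unique[OF f]) (simp add: vec_pair_scale)
  qed
  \<comment> \<open>The transpose is taken because matrices of the unitary group act on row vectors
    from the right.\<close>
  define a where "a = transpose (matrix f)"
  have a: "x v* a = f x" for x
    by (simp add: a_def matrix_works[OF linear])
  have isometry: "B (f x) (f y) = B x y" for x y
  proof -
    have "doubled_form B (vec_pair x (f x)) (vec_pair y (f y)) = 0"
      using iso f unfolding double.perp_def by blast
    then show ?thesis
      by (simp add: doubled_form_def)
  qed
  have "f x = 0 \<Longrightarrow> x = 0" for x
    using isometry[of x] by (intro eq_0_if_orthogonal) (simp add: B_zero_left)
  then have "\<forall>x. matrix f *v x = 0 \<longrightarrow> x = 0"
    by (simp add: matrix_works[OF linear])
  then have "invertible a"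
    by (simp only: a_def invertible_right_inverse right_invertible_transpose matrix_left_invertible_ker)
  then have "a \<in> unitary_group B"
    by (simp add: unitary_group_def a isometry)
  moreover have "graph a = L"
  proof (rule card_subset_eq)
    show "graph a \<subseteq> L"
      using f by (auto simp: graph_def a)
    show "card (graph a) = card L"
      unfolding card_L graph_def by (subst card_image) (auto simp: inj_on_def)
  qed simp
  ultimately show ?thesis by blast
qed

lemma bij_betw_graph:
  "bij_betw graph (unitary_group B) {L. double.lagrangian L \<and> (\<forall>y. vec_pair 0 y \<in> L \<longrightarrow> y = 0)}"
  unfolding bij_betw_def
proof
  show "inj_on graph (unitary_group B)"
  proof (rule inj_onI, rule vector_matrix_mult_eqI)
    fix a b :: "'a ^ 'n ^ 'n" and x
    assume "graph a = graph b"
    then have "vec_pair x (x v* a) \<in> graph b"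
      unfolding graph_def by blast
    then show "x v* a = x v* b"
      by (auto simp: graph_def)
  qed
  have "y = 0" if "vec_pair 0 y \<in> graph a" for y and a :: "'a ^ 'n ^ 'n"
    using that by (auto simp: graph_def)
  then show "graph ` unitary_group B = {L. double.lagrangian L \<and> (\<forall>y. vec_pair 0 y \<in> L \<longrightarrow> y = 0)}"
    using lagrangian_graph lagrangian_is_graph by (auto simp: image_iff)
qed

lemma weight_graph: "double.weight e (graph a) = real (card (displacements a)) ^ e"
proof -
  let ?f = "\<lambda>u. u - u v* a"
  have "graph a \<inter> diagonal = (\<lambda>x. vec_pair x x) ` {x. ?f x = 0}"
    by (auto simp: graph_def diagonal_def)
  then have card: "card (graph a \<inter> diagonal) = card {x. ?f x = 0}"
    by (simp add: card_image inj_on_def)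
  have "CARD('a ^ 'n) = card (displacements a) * card {x. ?f x = 0}"
    unfolding displacements_def
    by (rule card_range_kernel) (simp add: vector_matrix_left_distrib)
  moreover have "card {x. ?f x = 0} \<noteq> 0"
    by (auto intro: exI[of _ 0])
  ultimately have "real (CARD('a) ^ CARD('n)) / real (card {x. ?f x = 0}) = real (card (displacements a))"
    by (simp only: CARD_vec of_nat_mult) simp
  then show ?thesis
    by (simp only: double.weight_def card)
qed

section \<open>Summing over isometries by Moebius inversion\<close>

lemma sum_weight_vertical:
  assumes xs: "xs \<in> isotropic_lists k"
  shows "(\<Sum>L | double.lagrangian L \<and> vec_pair 0 ` set xs \<subseteq> L. double.weight e L) =
    real (CARD('a) ^ e) ^ k * qpoch ((- real q) ^ (2 * e + 1)) ((- real q)\<^sup>2) (CARD('n) - k)"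
proof -
  define R where "R = vec_pair 0 ` vec.span (set xs)"
  have k: "length xs = k" "indep xs" "k \<le> CARD('n)"
    using xs isotropic_lists_le[OF xs] by (auto simp: isotropic_lists_def)
  have R: "vec.subspace R"
    unfolding R_def vec.subspace_def
    by (auto simp: vec_pair_add vec_pair_scale vec.span_zero vec.span_add vec.span_scale
        intro!: image_eqI[of _ "vec_pair 0"] simp flip: vec_pair_0)
  have R_iso: "R \<subseteq> double.perp R"
    using xs totally_isotropic_span[of "set xs"]
    by (auto simp: R_def isotropic_lists_def double.perp_def perp_def doubled_form_def B_zero_left)
  have card_R: "card R = CARD('a) ^ k"
    unfolding R_def using k card_span_indep[of xs] by (simp add: card_image inj_on_def)
  \<comment> \<open>A vertical subspace meets the diagonal trivially, so the exponent
    \<open>j\<close> in \<open>sum_weight\<close> is 0.\<close>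
  have "R \<inter> diagonal = {0}"
  proof
    show "R \<inter> diagonal \<subseteq> {0}"
      by (auto simp: R_def diagonal_def vec_pair_0)
    show "{0} \<subseteq> R \<inter> diagonal"
      using vec.subspace_0[OF R] vec.subspace_0[OF double.subspace_D] by simp
  qed
  then have card_R_D: "card (R \<inter> diagonal) = CARD('a) ^ 0"
    by simp
  have "vec_pair 0 ` set xs \<subseteq> L \<longleftrightarrow> R \<subseteq> L" if "double.lagrangian L" for L
  proof
    assume *: "vec_pair 0 ` set xs \<subseteq> L"
    have "vec.span (set xs) \<subseteq> {y. vec_pair 0 y \<in> L}"
    proof (rule vec.span_minimal)
      show "set xs \<subseteq> {y. vec_pair 0 y \<in> L}"
        using * by auto
      show "vec.subspace {y. vec_pair 0 y \<in> L}"
        using that by (intro subspace_vertical) (simp add: double.lagrangian_def)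
    qed
    then show "R \<subseteq> L"
      by (auto simp: R_def)
  next
    assume "R \<subseteq> L"
    then show "vec_pair 0 ` set xs \<subseteq> L"
      using vec.span_superset[of "set xs"] by (auto simp: R_def)
  qed
  then have "{L. double.lagrangian L \<and> vec_pair 0 ` set xs \<subseteq> L} = {L. double.lagrangian L \<and> R \<subseteq> L}"
    by auto
  then have "(\<Sum>L | double.lagrangian L \<and> vec_pair 0 ` set xs \<subseteq> L. double.weight e L) =
      real (CARD('a) ^ e) ^ k * (\<Prod>i<CARD('n) - k. 1 + real (CARD('a) ^ e) * real q ^ (2 * i + 1))"
    using double.sum_weight[OF R R_iso card_R card_R_D k(3), of e] by simp
  \<comment> \<open>The exponent of \<open>q\<close> is odd, so passing to \<open>- q\<close>
    absorbs the plus sign and produces the factors of a shifted factorial.\<close>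
  moreover have "1 + real (CARD('a) ^ e) * real q ^ (2 * i + 1) =
      1 - (- real q) ^ (2 * e + 1) * ((- real q)\<^sup>2) ^ i" for i
    by (simp add: card_field flip: power_mult)
  ultimately show ?thesis
    unfolding qpoch_def by (simp only:)
qed

lemma sum_displacements:
  defines "p \<equiv> - real q"
  shows "(\<Sum>a\<in>unitary_group B. real (card (displacements a)) ^ e) =
    qpoch p p CARD('n) * (\<Sum>k\<le>CARD('n). summand e CARD('n) k)"
proof -
  let ?m = "CARD('n)"
  let ?Q = "p\<^sup>2"
  define X where "X L = {y :: 'a ^ 'n. vec_pair 0 y \<in> L}" for L
  define I where "I k = {xs :: ('a ^ 'n) list. length xs = k \<and> indep xs}" for k
  have fin_I: "finite (I k)" for k
    using finite_lists_length_eq[of "UNIV :: ('a ^ 'n) set" k] unfolding I_def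
    by (rule finite_subset[rotated]) auto
  have Q: "?Q = real CARD('a)"
    by (simp add: p_def card_field)
  have Q_neq_1: "?Q ^ i \<noteq> 1" if "i > 0" for i
    using power_neq_1[of "2 * i"] that by (simp add: p_def power_mult)
  \<comment> \<open>\<open>X L\<close> is the vertical part of \<open>L\<close>, and
    \<open>L\<close> is a graph exactly if it is zero; the left side is the indicator of this event
    as a sum over independent lists in \<open>X L\<close>.\<close>
  have moebius: "(\<Sum>k\<le>?m. real (card {xs \<in> I k. set xs \<subseteq> X L}) / qpoch ?Q ?Q k) =
      (if X L = {0} then 1 else 0)" if L: "double.lagrangian L" for L
  proof -
    have sub_L: "vec.subspace L" and "card L = CARD('a) ^ ?m"
      using L by (auto simp: double.lagrangian_def)
    have sub: "vec.subspace (X L)"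
      using sub_L unfolding X_def by (rule subspace_vertical)
    then obtain r where r: "card (X L) = CARD('a) ^ r"
      using card_subspace_power by blast
    have "card (vec_pair 0 ` X L) \<le> card L"
      by (intro card_mono) (auto simp: X_def)
    then have "card (X L) \<le> card L"
      by (simp add: card_image inj_on_def)
    \<comment> \<open>The inversion sum is cut off at \<open>?m\<close>, so the dimension of
      \<open>X L\<close> must not exceed \<open>?m\<close>.\<close>
    then have r_le: "r \<le> ?m"
      using r \<open>card L = _\<close> card_field_gt_1 by (simp add: power_increasing_iff)
    have "X L = {0} \<longleftrightarrow> card (X L) = 1"
      using vec.subspace_0[OF sub] by (auto simp: card_1_singleton_iff)
    also have "\<dots> \<longleftrightarrow> r = 0"
      using r card_field_gt_1 by (simp add: power_eq_1_iff)
    finally have r_0: "X L = {0} \<longleftrightarrow> r = 0" .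
    have "real (card {xs \<in> I k. set xs \<subseteq> X L}) = (\<Prod>i<k. ?Q ^ r - ?Q ^ i)" for k
      using card_indep_lists[OF sub, of k] unfolding Q I_def r by (simp add: conj_assoc)
    then show ?thesis
      using sum_qpoch_quotient_power[OF Q_neq_1 r_le] r_0 by simp
  qed
  have "(\<Sum>a\<in>unitary_group B. real (card (displacements a)) ^ e) =
      (\<Sum>L | double.lagrangian L \<and> (\<forall>y. vec_pair 0 y \<in> L \<longrightarrow> y = 0). double.weight e L)"
    using sum.reindex_bij_betw[OF bij_betw_graph, of "double.weight e"] by (simp add: weight_graph)
  also have "\<dots> = (\<Sum>L | double.lagrangian L. if X L = {0} then double.weight e L else 0)"
  proof -
    have "X L = {0} \<longleftrightarrow> (\<forall>y. vec_pair 0 y \<in> L \<longrightarrow> y = 0)" if "double.lagrangian L" for L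
      using that vec.subspace_0[of L] by (auto simp: X_def double.lagrangian_def vec_pair_0)
    then have "{L. double.lagrangian L \<and> (\<forall>y. vec_pair 0 y \<in> L \<longrightarrow> y = 0)} =
        {L \<in> {L. double.lagrangian L}. X L = {0}}"
      by auto
    then show ?thesis
      by (simp only:) (rule sum.inter_filter, simp)
  qed
  also have "\<dots> = (\<Sum>L | double.lagrangian L. \<Sum>k\<le>?m.
      (\<Sum>xs | xs \<in> I k \<and> set xs \<subseteq> X L. double.weight e L) / qpoch ?Q ?Q k)"
  proof (rule sum.cong[OF refl])
    fix L assume "L \<in> {L. double.lagrangian L}"
    then have "(if X L = {0} then double.weight e L else 0) =
        (\<Sum>k\<le>?m. real (card {xs \<in> I k. set xs \<subseteq> X L}) / qpoch ?Q ?Q k) * double.weight e L"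
      using moebius[of L] by simp
    then show "(if X L = {0} then double.weight e L else 0) =
        (\<Sum>k\<le>?m. (\<Sum>xs | xs \<in> I k \<and> set xs \<subseteq> X L. double.weight e L) / qpoch ?Q ?Q k)"
      by (simp add: sum_distrib_right)
  qed
  also have "\<dots> = (\<Sum>k\<le>?m. (\<Sum>L | double.lagrangian L. \<Sum>xs | xs \<in> I k \<and> set xs \<subseteq> X L.
      double.weight e L) / qpoch ?Q ?Q k)"
    by (subst sum.swap) (simp add: sum_divide_distrib)
  also have "\<dots> = (\<Sum>k\<le>?m. (\<Sum>xs\<in>I k. \<Sum>L | double.lagrangian L \<and> vec_pair 0 ` set xs \<subseteq> L.
      double.weight e L) / qpoch ?Q ?Q k)"
  proof (intro sum.cong refl arg_cong2[where f = "(/)"])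
    fix k
    have "set xs \<subseteq> X L \<longleftrightarrow> vec_pair 0 ` set xs \<subseteq> L" for xs L
      by (auto simp: X_def)
    then show "(\<Sum>L | double.lagrangian L. \<Sum>xs | xs \<in> I k \<and> set xs \<subseteq> X L. double.weight e L) =
        (\<Sum>xs\<in>I k. \<Sum>L | double.lagrangian L \<and> vec_pair 0 ` set xs \<subseteq> L. double.weight e L)"
      using sum.swap_restrict[of "{L. double.lagrangian L}" "I k" "\<lambda>L xs. double.weight e L"
          "\<lambda>L xs. vec_pair 0 ` set xs \<subseteq> L"] fin_I by simp
  qed
  also have "\<dots> = (\<Sum>k\<le>?m. qpoch p p ?m * summand e ?m k)"
  proof (intro sum.cong refl)
    fix k assume k: "k \<in> {..?m}"
    define c where "c = real (CARD('a) ^ e) ^ k * qpoch (p ^ (2 * e + 1)) (p\<^sup>2) (?m - k)"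
    have "(\<Sum>L | double.lagrangian L \<and> vec_pair 0 ` set xs \<subseteq> L. double.weight e L) =
        (if xs \<in> isotropic_lists k then c else 0)" if xs: "xs \<in> I k" for xs
    proof (cases "xs \<in> isotropic_lists k")
      case True
      then show ?thesis
        using sum_weight_vertical[OF True, of e] by (simp add: c_def p_def)
    next
      case False
      then obtain x y where xy: "x \<in> set xs" "y \<in> set xs" "B x y \<noteq> 0"
        using xs by (auto simp: isotropic_lists_def I_def perp_def)
      \<comment> \<open>On vertical vectors the doubled form is \<open>- B\<close>, so a list that
        is not totally isotropic for \<open>B\<close> lies in no Lagrangian.\<close>
      have "\<not> vec_pair 0 ` set xs \<subseteq> L" if "double.lagrangian L" for L
      proof
        assume "vec_pair 0 ` set xs \<subseteq> L"
        then have "doubled_form B (vec_pair 0 x) (vec_pair 0 y) = 0"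
          using that xy unfolding double.lagrangian_def double.perp_def by blast
        then show False
          using xy by (simp add: doubled_form_def B_zero_left)
      qed
      then have "{L. double.lagrangian L \<and> vec_pair 0 ` set xs \<subseteq> L} = {}" by blast
      then show ?thesis
        using False by (simp only: sum.empty if_False)
    qed
    then have "(\<Sum>xs\<in>I k. \<Sum>L | double.lagrangian L \<and> vec_pair 0 ` set xs \<subseteq> L. double.weight e L) =
        (\<Sum>xs\<in>I k. if xs \<in> isotropic_lists k then c else 0)"
      by simp
    also have "\<dots> = (\<Sum>xs\<in>I k \<inter> isotropic_lists k. c)"
      by (rule sum.inter_restrict[OF fin_I, symmetric])
    also have "I k \<inter> isotropic_lists k = isotropic_lists k"
      by (auto simp: I_def isotropic_lists_def)
    finally have "(\<Sum>xs\<in>I k. \<Sum>L | double.lagrangian L \<and> vec_pair 0 ` set xs \<subseteq> L. double.weight e L) =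
        real (card (isotropic_lists k)) * c"
      by simp
    moreover have "real (CARD('a) ^ e) = p ^ (2 * e)"
      by (simp add: p_def card_field flip: power_mult)
    ultimately show "(\<Sum>xs\<in>I k. \<Sum>L | double.lagrangian L \<and> vec_pair 0 ` set xs \<subseteq> L. double.weight e L) /
        qpoch ?Q ?Q k = qpoch p p ?m * summand e ?m k"
      by (simp add: card_isotropic_lists summand_def c_def p_def del: of_nat_power)
  qed
  finally show ?thesis
    by (simp add: sum_distrib_left)
qed

section \<open>From the sum of image sizes to the proportion of derangements\<close>

lemma derangement_proportion_eq:
  "derangement_proportion (affine_unitary_group B) =
     1 - (\<Sum>a\<in>unitary_group B. real (card (displacements a))) /
       (real (card (unitary_group B)) * real (CARD('a) ^ CARD('n)))"
proof -
  let ?F = "\<lambda>(a :: 'a ^ 'n ^ 'n, v :: 'a ^ 'n) u. u v* a + v"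
  let ?U = "unitary_group B"
  have fin: "finite ?U"
    by simp
  have "mat 1 \<in> ?U"
    by (rule mat_1_in_unitary_group)
  then have pos: "card ?U > 0"
    using fin by (auto simp: card_gt_0_iff)
  have inj: "inj ?F"
  proof (rule injI, clarify)
    fix a b :: "'a ^ 'n ^ 'n" and v w :: "'a ^ 'n"
    assume eq: "(\<lambda>u. u v* a + v) = (\<lambda>u. u v* b + w)"
    from fun_cong[OF eq, of 0] have "v = w" by simp
    moreover from this have "a = b"
      using fun_cong[OF eq] by (intro vector_matrix_mult_eqI) simp
    ultimately show "a = b \<and> v = w" by simp
  qed
  have derangement: "derangement (?F (a, v)) \<longleftrightarrow> v \<notin> displacements a" for a v
  proof -
    have "u v* a + v = u \<longleftrightarrow> v = u - u v* a" for u
      by (auto simp: algebra_simps)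
    then show ?thesis
      by (auto simp: derangement_def displacements_def)
  qed
  have "{g \<in> affine_unitary_group B. derangement g} = ?F ` (SIGMA a : ?U. - displacements a)"
  proof (rule Set.set_eqI)
    fix g
    have "g \<in> affine_unitary_group B \<longleftrightarrow> (\<exists>a v. a \<in> ?U \<and> g = ?F (a, v))"
      unfolding affine_unitary_group_def by auto
    moreover have "g \<in> ?F ` (SIGMA a : ?U. - displacements a) \<longleftrightarrow>
        (\<exists>a v. a \<in> ?U \<and> v \<notin> displacements a \<and> g = ?F (a, v))"
      by (auto simp: image_iff)
    ultimately show "g \<in> {g \<in> affine_unitary_group B. derangement g} \<longleftrightarrow>
        g \<in> ?F ` (SIGMA a : ?U. - displacements a)"
      using derangement by blast
  qed
  then have "card {g \<in> affine_unitary_group B. derangement g} = card (SIGMA a : ?U. - displacements a)"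
    using inj by (simp add: card_image inj_on_subset)
  also have "\<dots> = (\<Sum>a\<in>?U. card (- displacements a))"
    using fin by simp
  finally have "real (card {g \<in> affine_unitary_group B. derangement g}) =
      (\<Sum>a\<in>?U. real (card (- displacements a)))"
    by simp
  also have "\<dots> = (\<Sum>a\<in>?U. real (CARD('a) ^ CARD('n)) - real (card (displacements a)))"
  proof (rule sum.cong[OF refl])
    fix a :: "'a ^ 'n ^ 'n"
    have "card (displacements a) \<le> CARD('a ^ 'n)"
      by (rule card_mono) auto
    then show "real (card (- displacements a)) = real (CARD('a) ^ CARD('n)) - real (card (displacements a))"
      by (simp add: Compl_eq_Diff_UNIV card_Diff_subset of_nat_diff)
  qed
  also have "\<dots> = real (card ?U) * real (CARD('a) ^ CARD('n)) - (\<Sum>a\<in>?U. real (card (displacements a)))"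
    by (simp add: sum_subtractf)
  finally show ?thesis
    using pos unfolding derangement_proportion_def card_affine_unitary_group
    by (simp add: diff_divide_distrib card_gt_0_iff)
qed

end

theorem theorem1p1:
  fixes q m :: nat
    and B :: "'a::{field,finite} ^ 'm::finite \<Rightarrow> 'a ^ 'm \<Rightarrow> 'a"
  assumes "primepow q"
    and "CARD('a) = q\<^sup>2"
    and "CARD('m) = m"
    and "hermitian_form q B"
    and "nondegenerate B"
  shows "derangement_proportion (affine_unitary_group B) =
           1 / (real q + 1) * (1 - 1 / (- real q) ^ (m * (m + 3) div 2))"
proof -
  interpret hermitian_space q B
    using assms by unfold_locales
  define p where "p = - real q"
  define N where "N = qpoch p p m"
  define E where "E = m * (m + 3) div 2"
  have ne: "N \<noteq> 0" "p \<noteq> 0" "1 - p \<noteq> 0"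
    using qpoch_neq_0(1) power_neq_1[of 1] q_gt_1 by (auto simp: N_def p_def)
  \<comment> \<open>For \<open>e = 0\<close> every weight is 1, so the sum is the order of the
    group.\<close>
  have "real (card (unitary_group B)) = N * p ^ (m * (m - 1) div 2)"
    using sum_displacements[of 0] sum_summand_0[of m m] by (simp add: assms(3) p_def N_def)
  moreover have "(\<Sum>a\<in>unitary_group B. real (card (displacements a))) =
      N * ((1 - p ^ ((m + 1) * (m + 2) div 2)) / (1 - p))"
  proof -
    have "(\<Sum>k\<le>m. summand 1 m k) = (1 - p ^ ((m + 1) * (m + 2) div 2)) / (1 - p)"
      using sum_summand_1[of m] ne(3) unfolding p_def[symmetric] by (metis nonzero_mult_div_cancel_left)
    then show ?thesis
      using sum_displacements[of 1] by (simp only: assms(3) power_one_right p_def N_def)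
  qed
  moreover have "real (CARD('a) ^ CARD('m)) = p ^ (2 * m)"
    by (simp add: assms(3) card_field p_def flip: power_mult)
  ultimately have "derangement_proportion (affine_unitary_group B) =
      1 - N * ((1 - p ^ ((m + 1) * (m + 2) div 2)) / (1 - p)) /
        (N * p ^ (m * (m - 1) div 2) * p ^ (2 * m))"
    by (simp only: derangement_proportion_eq)
  also have "\<dots> = 1 - (1 - p ^ ((m + 1) * (m + 2) div 2)) / ((1 - p) * (p ^ (m * (m - 1) div 2) * p ^ (2 * m)))"
    using ne by simp
  also have "p ^ (m * (m - 1) div 2) * p ^ (2 * m) = p ^ E"
  proof -
    have "m * (m + 3) = m * (m - 1) + 2 * m * 2"
      by (cases m) (auto simp: algebra_simps)
    then have "m * (m - 1) div 2 + 2 * m = E"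
      unfolding E_def by simp
    then show ?thesis
      by (simp only: power_add[symmetric])
  qed
  \<comment> \<open>Because of this shift by one, \<open>p ^ Suc E\<close> cancels against
    \<open>p * p ^ E\<close> when the fraction is subtracted from 1.\<close>
  also have "(m + 1) * (m + 2) div 2 = Suc E"
  proof -
    have "(m + 1) * (m + 2) = m * (m + 3) + 2"
      by (simp add: algebra_simps)
    then show ?thesis
      unfolding E_def by simp
  qed
  also have "1 - (1 - p ^ Suc E) / ((1 - p) * p ^ E) = 1 / (1 - p) * (1 - 1 / p ^ E)"
    using ne by (simp add: field_simps)
  finally show ?thesis
    by (simp add: p_def E_def add.commute)
qed

end
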